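(* Let $(M,g)$ be an $n$-dimensional Riemannian manifold with $n>2$, let $f,\lambda,\mu$ be smooth functions on $M$, let $\xi:=\mathrm{grad}(f)$ and let $\eta=df$ be the $g$-dual $1$-form of $\xi$. Suppose that $(g,\xi,\lambda,\mu)$ is a gradient almost quasi-Yamabe soliton on $M$, i.e. $$\mathrm{Hess}(f)+(\lambda-\mathrm{scal})\,g+\mu\, df\otimes df=0 .$$ Then $$\frac{1}{2}\Delta(|\xi|^2)=|\nabla \xi|^2-\frac{1}{n-1}S(\xi,\xi)-\frac{n-2}{2(n-1)}\,\mu\, \nabla_{\xi}(|\xi|^2)-|\xi|^2\left[\xi(\mu)-\frac{n}{n-1}\mu^2|\xi|^2-\frac{n^2}{n-1}\lambda \mu+\frac{n^2}{n-1}\mu\, \mathrm{scal}\right].$$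
   Context: $\nabla$ is the Levi-Civita connection of $g$, $S$ is the Ricci tensor, $\mathrm{scal}$ is the scalar curvature of $(M,g)$, $\mathrm{Hess}(f)(X,Y)=g(\nabla_X\mathrm{grad}(f),Y)$, and $\Delta=\mathrm{div}\circ\mathrm{grad}$ (the trace of the Hessian). Norms are taken with respect to $g$; $|\nabla\xi|^2$ is the squared norm of the endomorphism field $X\mapsto\nabla_X\xi$. For a function $u$, $\nabla_\xi u=\xi(u)=du(\xi)$. *)

theory Defs
  imports "HOL-Analysis.Analysis"
begin

section \<open>Smooth maps between open subsets of normed spaces\<close>

fun Ck_on :: "nat \<Rightarrow> 'a::real_normed_vector set \<Rightarrow> ('a \<Rightarrow> 'b::real_normed_vector) \<Rightarrow> bool" where
  "Ck_on 0 S h \<longleftrightarrow> continuous_on S h"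
| "Ck_on (Suc k) S h \<longleftrightarrow>
     (\<forall>x\<in>S. h differentiable (at x)) \<and>
     (\<forall>v. Ck_on k S (\<lambda>x. frechet_derivative h (at x) v))"

definition Cinf_on :: "'a::real_normed_vector set \<Rightarrow> ('a \<Rightarrow> 'b::real_normed_vector) \<Rightarrow> bool" where
  "Cinf_on S h \<longleftrightarrow> open S \<and> (\<forall>k. Ck_on k S h)"


section \<open>Smooth manifolds of dimension \<open>CARD('n)\<close>\<close>

record ('a, 'n::finite) mfd =
  mtop :: "'a topology"
  charts :: "('a set \<times> ('a \<Rightarrow> real ^ 'n)) set"

abbreviation pts :: "('a, 'n::finite) mfd \<Rightarrow> 'a set" where
  "pts M \<equiv> topspace (mtop M)"

definition smooth_manifold :: "('a, 'n::finite) mfd \<Rightarrow> bool" where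
  "smooth_manifold M \<longleftrightarrow>
     Hausdorff_space (mtop M) \<and> second_countable (mtop M) \<and>
     (\<Union>(U, \<phi>)\<in>charts M. U) = pts M \<and>
     (\<forall>(U, \<phi>)\<in>charts M. openin (mtop M) U \<and> open (\<phi> ` U) \<and>
        homeomorphic_map (subtopology (mtop M) U) (top_of_set (\<phi> ` U)) \<phi>) \<and>
     (\<forall>(U, \<phi>)\<in>charts M. \<forall>(V, \<psi>)\<in>charts M. Cinf_on (\<phi> ` (U \<inter> V)) (\<psi> \<circ> inv_into U \<phi>))"

text \<open>Functions, vector fields and so on that live on an open set \<open>W\<close> are total HOL functions
  whose values outside \<open>W\<close> are irrelevant.\<close>

definition smooth_fun :: "('a, 'n::finite) mfd \<Rightarrow> 'a set \<Rightarrow> ('a \<Rightarrow> real) \<Rightarrow> bool" where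
  "smooth_fun M W u \<longleftrightarrow> openin (mtop M) W \<and>
     (\<forall>(U, \<phi>)\<in>charts M. Cinf_on (\<phi> ` (U \<inter> W)) (u \<circ> inv_into U \<phi>))"

definition smooth_near :: "('a, 'n::finite) mfd \<Rightarrow> 'a \<Rightarrow> ('a \<Rightarrow> real) \<Rightarrow> bool" where
  "smooth_near M p u \<longleftrightarrow> (\<exists>W. p \<in> W \<and> smooth_fun M W u)"


section \<open>Tangent vectors and vector fields\<close>

text \<open>A tangent vector at \<open>p\<close> is a combination of the coordinate derivations at \<open>p\<close>, acting on
  the real functions that are smooth near \<open>p\<close>.  It is set to \<open>0\<close> on all other functions, so that
  equality of tangent vectors is equality of functionals.\<close>

type_synonym 'a tvec = "('a \<Rightarrow> real) \<Rightarrow> real"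

type_synonym 'a vfield = "'a \<Rightarrow> 'a tvec"

definition tangent_space :: "('a, 'n::finite) mfd \<Rightarrow> 'a \<Rightarrow> 'a tvec set" where
  "tangent_space M p =
     {v. \<exists>(U, \<phi>)\<in>charts M. p \<in> U \<and>
          (\<exists>w. v = (\<lambda>u. if smooth_near M p u
                        then frechet_derivative (u \<circ> inv_into U \<phi>) (at (\<phi> p)) w else 0))}"

text \<open>For a vector field \<open>X\<close> and a function \<open>u\<close>, the function \<open>X(u) = du(X)\<close> is
  \<open>\<lambda>p. X p u\<close>.\<close>

definition smooth_field :: "('a, 'n::finite) mfd \<Rightarrow> 'a set \<Rightarrow> 'a vfield \<Rightarrow> bool" where
  "smooth_field M W X \<longleftrightarrow> openin (mtop M) W \<and>
     (\<forall>p\<in>W. X p \<in> tangent_space M p) \<and>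
     (\<forall>V u. V \<subseteq> W \<and> smooth_fun M V u \<longrightarrow> smooth_fun M V (\<lambda>p. X p u))"

definition field_add :: "'a vfield \<Rightarrow> 'a vfield \<Rightarrow> 'a vfield" where
  "field_add X Y = (\<lambda>p u. X p u + Y p u)"

definition field_mult :: "('a \<Rightarrow> real) \<Rightarrow> 'a vfield \<Rightarrow> 'a vfield" where
  "field_mult h X = (\<lambda>p u. h p * X p u)"

definition lie_bracket :: "('a, 'n::finite) mfd \<Rightarrow> 'a vfield \<Rightarrow> 'a vfield \<Rightarrow> 'a vfield" where
  "lie_bracket M X Y = (\<lambda>p u. if smooth_near M p u
      then X p (\<lambda>q. Y q u) - Y p (\<lambda>q. X q u) else 0)"


section \<open>Riemannian metrics and the Levi-Civita connection\<close>

type_synonym 'a metric = "'a \<Rightarrow> 'a tvec \<Rightarrow> 'a tvec \<Rightarrow> real"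

definition riemannian_metric :: "('a, 'n::finite) mfd \<Rightarrow> 'a metric \<Rightarrow> bool" where
  "riemannian_metric M g \<longleftrightarrow>
     (\<forall>p\<in>pts M. \<forall>v\<in>tangent_space M p.
        (\<forall>w\<in>tangent_space M p. g p v w = g p w v) \<and>
        (v \<noteq> (\<lambda>_. 0) \<longrightarrow> g p v v > 0) \<and>
        (\<forall>w\<in>tangent_space M p. \<forall>z\<in>tangent_space M p. \<forall>a b.
           g p (\<lambda>u. a * v u + b * w u) z = a * g p v z + b * g p w z)) \<and>
     (\<forall>W X Y. smooth_field M W X \<and> smooth_field M W Y \<longrightarrow>
        smooth_fun M W (\<lambda>p. g p (X p) (Y p)))"

text \<open>A connection is regarded as acting on smooth vector fields on arbitrary open subsets (every
  connection on \<open>M\<close> restricts uniquely to open subsets).  Compatibility with restriction is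
  contained in the axioms: functions that vanish on \<open>W\<close> and are arbitrary outside are smooth
  on \<open>W\<close>, so the values on \<open>W\<close> depend only on the fields on \<open>W\<close>.\<close>

type_synonym 'a connection = "'a vfield \<Rightarrow> 'a vfield \<Rightarrow> 'a vfield"

definition affine_connection :: "('a, 'n::finite) mfd \<Rightarrow> 'a connection \<Rightarrow> bool" where
  "affine_connection M nabla \<longleftrightarrow>
     (\<forall>W X Y. smooth_field M W X \<and> smooth_field M W Y \<longrightarrow>
        smooth_field M W (nabla X Y) \<and>
        (\<forall>Z. smooth_field M W Z \<longrightarrow> (\<forall>p\<in>W.
           nabla (field_add X Z) Y p = field_add (nabla X Y) (nabla Z Y) p \<and>
           nabla X (field_add Y Z) p = field_add (nabla X Y) (nabla X Z) p)) \<and>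
        (\<forall>h. smooth_fun M W h \<longrightarrow> (\<forall>p\<in>W.
           nabla (field_mult h X) Y p = field_mult h (nabla X Y) p \<and>
           nabla X (field_mult h Y) p =
             field_add (field_mult (\<lambda>q. X q h) Y) (field_mult h (nabla X Y)) p)))"

definition levi_civita :: "('a, 'n::finite) mfd \<Rightarrow> 'a metric \<Rightarrow> 'a connection \<Rightarrow> bool" where
  "levi_civita M g nabla \<longleftrightarrow> affine_connection M nabla \<and>
     (\<forall>W X Y. smooth_field M W X \<and> smooth_field M W Y \<longrightarrow> (\<forall>p\<in>W.
        (\<forall>u. nabla X Y p u - nabla Y X p u = lie_bracket M X Y p u) \<and>
        (\<forall>Z. smooth_field M W Z \<longrightarrow>
           X p (\<lambda>q. g q (Y q) (Z q)) =
             g p (nabla X Y p) (Z p) + g p (Y p) (nabla X Z p))))"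


section \<open>Traces, differential operators and curvature\<close>

text \<open>Smooth fields \<open>E i\<close> defined near \<open>p\<close> that are orthonormal at \<open>p\<close>.  The traces below do
  not depend on the choice.\<close>

definition frame_at :: "('a, 'n::finite) mfd \<Rightarrow> 'a metric \<Rightarrow> 'a \<Rightarrow> ('n \<Rightarrow> 'a vfield) \<Rightarrow> bool" where
  "frame_at M g p E \<longleftrightarrow>
     (\<exists>W. p \<in> W \<and> (\<forall>i. smooth_field M W (E i))) \<and>
     (\<forall>i j. g p (E i p) (E j p) = (if i = j then 1 else 0))"

definition some_frame :: "('a, 'n::finite) mfd \<Rightarrow> 'a metric \<Rightarrow> 'a \<Rightarrow> 'n \<Rightarrow> 'a vfield" where
  "some_frame M g p = (SOME E. frame_at M g p E)"

text \<open>The trace at \<open>p\<close> of a tensorial map from vector fields to vector fields.\<close>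

definition trace_at ::
    "('a, 'n::finite) mfd \<Rightarrow> 'a metric \<Rightarrow> 'a \<Rightarrow> ('a vfield \<Rightarrow> 'a vfield) \<Rightarrow> real" where
  "trace_at M g p T = (\<Sum>i\<in>UNIV. g p (T (some_frame M g p i) p) (some_frame M g p i p))"

text \<open>The squared norm at \<open>p\<close> of such a map.\<close>

definition end_normsq ::
    "('a, 'n::finite) mfd \<Rightarrow> 'a metric \<Rightarrow> 'a \<Rightarrow> ('a vfield \<Rightarrow> 'a vfield) \<Rightarrow> real" where
  "end_normsq M g p T =
     (\<Sum>i\<in>UNIV. g p (T (some_frame M g p i) p) (T (some_frame M g p i) p))"

definition normsq :: "'a metric \<Rightarrow> 'a vfield \<Rightarrow> 'a \<Rightarrow> real" where
  "normsq g X p = g p (X p) (X p)"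

definition grad :: "('a, 'n::finite) mfd \<Rightarrow> 'a metric \<Rightarrow> ('a \<Rightarrow> real) \<Rightarrow> 'a vfield" where
  "grad M g u p = (THE v. v \<in> tangent_space M p \<and> (\<forall>w\<in>tangent_space M p. g p v w = w u))"

definition divergence ::
    "('a, 'n::finite) mfd \<Rightarrow> 'a metric \<Rightarrow> 'a connection \<Rightarrow> 'a vfield \<Rightarrow> 'a \<Rightarrow> real" where
  "divergence M g nabla X p = trace_at M g p (\<lambda>Y. nabla Y X)"

definition laplacian ::
    "('a, 'n::finite) mfd \<Rightarrow> 'a metric \<Rightarrow> 'a connection \<Rightarrow> ('a \<Rightarrow> real) \<Rightarrow> 'a \<Rightarrow> real" where
  "laplacian M g nabla u = divergence M g nabla (grad M g u)"

definition hess :: "('a, 'n::finite) mfd \<Rightarrow> 'a metric \<Rightarrow> 'a connection \<Rightarrow> ('a \<Rightarrow> real) \<Rightarrow>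
    'a vfield \<Rightarrow> 'a vfield \<Rightarrow> 'a \<Rightarrow> real" where
  "hess M g nabla u X Y p = g p (nabla X (grad M g u) p) (Y p)"

definition curvature :: "('a, 'n::finite) mfd \<Rightarrow> 'a connection \<Rightarrow>
    'a vfield \<Rightarrow> 'a vfield \<Rightarrow> 'a vfield \<Rightarrow> 'a vfield" where
  "curvature M nabla X Y Z = (\<lambda>p u. nabla X (nabla Y Z) p u - nabla Y (nabla X Z) p u
      - nabla (lie_bracket M X Y) Z p u)"

text \<open>\<open>S(Y, Z)\<close> is the trace of \<open>X \<mapsto> R(X, Y)Z\<close>; with the sign of \<open>R\<close> above, round spheres have
  positive Ricci curvature.\<close>

definition ricci :: "('a, 'n::finite) mfd \<Rightarrow> 'a metric \<Rightarrow> 'a connection \<Rightarrow>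
    'a vfield \<Rightarrow> 'a vfield \<Rightarrow> 'a \<Rightarrow> real" where
  "ricci M g nabla Y Z p = trace_at M g p (\<lambda>X. curvature M nabla X Y Z)"

definition scal :: "('a, 'n::finite) mfd \<Rightarrow> 'a metric \<Rightarrow> 'a connection \<Rightarrow> 'a \<Rightarrow> real" where
  "scal M g nabla p =
     (\<Sum>i\<in>UNIV. ricci M g nabla (some_frame M g p i) (some_frame M g p i) p)"


section \<open>Gradient almost quasi-Yamabe solitons\<close>

text \<open>The potential vector field of the soliton is \<open>grad f\<close>.  As an identity of tensors, the
  soliton equation is required for all local smooth vector fields.\<close>

definition gradient_almost_quasi_yamabe :: "('a, 'n::finite) mfd \<Rightarrow> 'a metric \<Rightarrow>
    'a connection \<Rightarrow> ('a \<Rightarrow> real) \<Rightarrow> ('a \<Rightarrow> real) \<Rightarrow> ('a \<Rightarrow> real) \<Rightarrow> bool" where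
  "gradient_almost_quasi_yamabe M g nabla f lam mu \<longleftrightarrow>
     (\<forall>W X Y. smooth_field M W X \<and> smooth_field M W Y \<longrightarrow> (\<forall>p\<in>W.
        hess M g nabla f X Y p + (lam p - scal M g nabla p) * g p (X p) (Y p)
          + mu p * (X p f * Y p f) = 0))"

end

theory Submission
  imports Defs
begin

text \<open>
Write \<open>\<phi> = scal - \<lambda>\<close> and \<open>s = |\<xi>|\<^sup>2 = \<xi>(f)\<close>.  The soliton equation says
\<open>\<nabla>\<^sub>X \<xi> = \<phi> X - \<mu> df(X) \<xi>\<close> for all \<open>X\<close> (lemma \<open>nabla_xi\<close>), and everything is a consequence of this
formula for the covariant derivative of \<open>\<xi>\<close>.

Taking the inner product with \<open>\<xi>\<close> gives \<open>X(s) = 2 \<psi> df(X)\<close> with \<open>\<psi> = \<phi> - \<mu> s\<close>, that is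
\<open>grad s = 2 \<psi> \<xi>\<close>, whose divergence is \<open>\<Delta> s = 2 \<xi>(\<psi>) + 2 \<psi> (n \<phi> - \<mu> s)\<close> (lemma
\<open>laplacian_normsq\<close>).  Here \<open>\<xi>(\<psi>) = \<xi>(\<phi>) - \<xi>(\<mu>) s - 2 \<mu> \<psi> s\<close>.  The derivative \<open>\<xi>(\<phi>)\<close> comes from the
Ricci curvature: differentiating the formula for \<open>\<nabla>\<xi>\<close> once more gives \<open>R(X,\<xi>)\<xi>\<close> (lemma
\<open>curvature_xi\<close>), and its trace is \<open>S(\<xi>,\<xi>) = - (n - 1) (\<xi>(\<phi>) + \<mu> \<phi> s)\<close> (lemma \<open>ricci_xi_xi\<close>).
Moreover \<open>|\<nabla>\<xi>|\<^sup>2 = n \<phi>\<^sup>2 - 2 \<mu> \<phi> s + \<mu>\<^sup>2 s\<^sup>2\<close> (lemma \<open>end_normsq_nabla_xi\<close>).  After these substitutions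
both sides of the claim are the same polynomial in \<open>\<phi>\<close>, \<open>\<mu>\<close>, \<open>s\<close>, \<open>\<xi>(\<phi>)\<close> and \<open>\<xi>(\<mu>)\<close>.

The computation rests on some local geometry.  In a chart the coordinate derivations identify each
tangent space with \<open>real ^ 'n\<close>; Gram-Schmidt applied to them gives a smooth orthogonal frame (lemma
\<open>orthogonal_frame\<close>), in which gradients have smooth coefficients (lemma \<open>grad_smooth\<close>); and
the covariant derivative depends only on the fields near the point (lemma \<open>nabla_cong\<close>).  The
function \<open>\<phi>\<close> may be differentiated because the soliton equation itself expresses it by smooth
functions (lemma \<open>phi_smooth\<close>).
\<close>

section \<open>Calculus of smooth maps\<close>

lemma frechet_derivative_transform_open:
  assumes "open S" "x \<in> S" "\<And>y. y \<in> S \<Longrightarrow> h y = k y" "h differentiable (at x)"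
  shows "k differentiable (at x)" "frechet_derivative k (at x) = frechet_derivative h (at x)"
proof -
  have "(h has_derivative frechet_derivative h (at x)) (at x)"
    using assms(4) by (simp add: frechet_derivative_works)
  then have "(k has_derivative frechet_derivative h (at x)) (at x)"
    by (rule has_derivative_transform_within_open[OF _ assms(1,2,3)])
  then show "k differentiable (at x)" "frechet_derivative k (at x) = frechet_derivative h (at x)"
    using frechet_derivative_at[symmetric] by (auto simp: differentiable_def)
qed

lemma Ck_on_cong:
  assumes "open S" "\<And>x. x \<in> S \<Longrightarrow> h x = k x" "Ck_on n S h"
  shows "Ck_on n S k"
  using assms(2,3)
proof (induction n arbitrary: h k)
  case 0
  have "continuous_on S h \<longleftrightarrow> continuous_on S k" by (rule continuous_on_cong) (use 0 in auto)
  with 0 show ?case by simp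
next
  case (Suc n)
  have 1: "h differentiable (at x)" if "x \<in> S" for x using Suc.prems(2) that by simp
  have 2: "Ck_on n S (\<lambda>x. frechet_derivative k (at x) v)" for v
  proof (rule Suc.IH[of "\<lambda>x. frechet_derivative h (at x) v"])
    show "Ck_on n S (\<lambda>x. frechet_derivative h (at x) v)" using Suc.prems(2) by simp
    show "frechet_derivative h (at x) v = frechet_derivative k (at x) v" if "x \<in> S" for x
      using frechet_derivative_transform_open(2)[of S x h k, OF assms(1) that Suc.prems(1) 1[OF that]]
      by simp
  qed
  have "k differentiable (at x)" if "x \<in> S" for x
    using frechet_derivative_transform_open(1)[of S x h k, OF assms(1) that Suc.prems(1) 1[OF that]] .
  with 2 show ?case by simp
qed

text \<open>The definition by recursion speaks of the chosen Frechet derivative; this rule accepts any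
  explicit formula \<open>D\<close> for the derivative, and the closure properties below all go through it.\<close>

lemma Ck_on_Suc_if:
  assumes "open S" "\<And>x. x \<in> S \<Longrightarrow> (h has_derivative D x) (at x)" "\<And>v. Ck_on k S (\<lambda>x. D x v)"
  shows "Ck_on (Suc k) S h"
proof -
  have "Ck_on k S (\<lambda>x. frechet_derivative h (at x) v)" for v
    by (rule Ck_on_cong[OF assms(1) _ assms(3)[of v]])
       (simp add: frechet_derivative_at[OF assms(2), symmetric])
  with assms(2) show ?thesis by (auto simp: differentiable_def)
qed

lemma Ck_on_subset: "Ck_on k S h \<Longrightarrow> T \<subseteq> S \<Longrightarrow> Ck_on k T h"
  by (induction k arbitrary: h) (auto intro: continuous_on_subset)

lemma Ck_on_local:
  assumes "\<And>x. x \<in> S \<Longrightarrow> \<exists>T. open T \<and> x \<in> T \<and> Ck_on k T h"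
  shows "Ck_on k S h"
  using assms
proof (induction k arbitrary: h)
  case 0
  then have "\<forall>x\<in>S. isCont h x"
    using continuous_on_eq_continuous_at by (metis Ck_on.simps(1))
  then show ?case by (simp add: continuous_at_imp_continuous_on)
next
  case (Suc k)
  have "\<exists>T. open T \<and> x \<in> T \<and> Ck_on k T (\<lambda>x. frechet_derivative h (at x) v)" if "x \<in> S" for x v
    using Suc.prems[OF that] by auto
  then have "Ck_on k S (\<lambda>x. frechet_derivative h (at x) v)" for v by (rule Suc.IH)
  moreover have "h differentiable (at x)" if "x \<in> S" for x using Suc.prems[OF that] by auto
  ultimately show ?case by simp
qed

lemma Ck_on_SucD: "Ck_on (Suc k) S h \<Longrightarrow> Ck_on k S h"
proof (induction k arbitrary: h)
  case 0 then show ?case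
    by (auto intro!: continuous_at_imp_continuous_on differentiable_imp_continuous_within)
next
  case (Suc k)
  then have "\<forall>v. Ck_on (Suc k) S (\<lambda>x. frechet_derivative h (at x) v)" by simp
  with Suc.IH have "\<forall>v. Ck_on k S (\<lambda>x. frechet_derivative h (at x) v)" by blast
  with Suc.prems show ?case by simp
qed

lemma Ck_on_derivative:
  assumes "Ck_on (Suc k) S h" "x \<in> S"
  shows "(h has_derivative frechet_derivative h (at x)) (at x)"
  using assms by (simp add: frechet_derivative_works)

lemma Ck_on_const: "open S \<Longrightarrow> Ck_on k S (\<lambda>_. c)"
proof (induction k arbitrary: c)
  case (Suc k) then show ?case
    by (intro Ck_on_Suc_if[where D="\<lambda>_ _. 0"]) auto
qed auto

lemma Ck_on_bounded_linear:
  assumes "open S" "bounded_linear L"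
  shows "Ck_on k S L"
proof (cases k)
  case 0 then show ?thesis using assms linear_continuous_on by auto
next
  case (Suc j)
  show ?thesis unfolding Suc
    by (intro Ck_on_Suc_if[where D="\<lambda>_. L"])
       (use assms bounded_linear_imp_has_derivative Ck_on_const in auto)
qed

lemma Ck_on_linear_compose:
  assumes "open S" "bounded_linear L" "Ck_on k S h"
  shows "Ck_on k S (\<lambda>x. L (h x))"
  using assms(3)
proof (induction k arbitrary: h)
  case 0 then show ?case using bounded_linear.continuous_on[OF assms(2)] by auto
next
  case (Suc k)
  show ?case
    by (rule Ck_on_Suc_if[OF assms(1),
          where D="\<lambda>x v. L (frechet_derivative h (at x) v)"])
       (use Suc in \<open>auto intro!: bounded_linear.has_derivative[OF assms(2)]
          simp: frechet_derivative_works[symmetric]\<close>)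
qed

lemma Ck_on_add:
  assumes "open S" "Ck_on k S h" "Ck_on k S l"
  shows "Ck_on k S (\<lambda>x. h x + l x)"
  using assms(2,3)
proof (induction k arbitrary: h l)
  case 0 then show ?case by (auto intro: continuous_on_add)
next
  case (Suc k)
  show ?case
    by (rule Ck_on_Suc_if[OF assms(1),
          where D="\<lambda>x v. frechet_derivative h (at x) v + frechet_derivative l (at x) v"])
       (use Suc in \<open>auto intro!: has_derivative_add simp: frechet_derivative_works[symmetric]\<close>)
qed

lemma Ck_on_mult:
  fixes h l :: "'a::real_normed_vector \<Rightarrow> real"
  assumes "open S" "Ck_on k S h" "Ck_on k S l"
  shows "Ck_on k S (\<lambda>x. h x * l x)"
  using assms(2,3)
proof (induction k arbitrary: h l)
  case 0 then show ?case by (auto intro: continuous_on_mult)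
next
  case (Suc k)
  show ?case
  proof (rule Ck_on_Suc_if[OF assms(1),
        where D="\<lambda>x v. h x * frechet_derivative l (at x) v + frechet_derivative h (at x) v * l x"])
    show "((\<lambda>x. h x * l x) has_derivative
        (\<lambda>v. h x * frechet_derivative l (at x) v + frechet_derivative h (at x) v * l x)) (at x)"
      if "x \<in> S" for x
      by (rule has_derivative_mult[OF Ck_on_derivative[OF Suc.prems(1) that]
            Ck_on_derivative[OF Suc.prems(2) that]])
    show "Ck_on k S (\<lambda>x. h x * frechet_derivative l (at x) v + frechet_derivative h (at x) v * l x)"
      for v
      using Suc.prems Ck_on_SucD[OF Suc.prems(1)] Ck_on_SucD[OF Suc.prems(2)]
      by (intro Ck_on_add assms(1) Suc.IH) (simp_all only: Ck_on.simps)
  qed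
qed

lemma Ck_on_inverse:
  fixes h :: "'a::real_normed_vector \<Rightarrow> real"
  assumes "open S" "Ck_on k S h" "\<And>x. x \<in> S \<Longrightarrow> h x \<noteq> 0"
  shows "Ck_on k S (\<lambda>x. inverse (h x))"
  using assms(2)
proof (induction k)
  case 0 then show ?case using assms(3) by (auto intro!: continuous_on_inverse)
next
  case (Suc k)
  show ?case
  proof (rule Ck_on_Suc_if[OF assms(1),
        where D="\<lambda>x v. (- 1) * (inverse (h x) * frechet_derivative h (at x) v * inverse (h x))"])
    show "((\<lambda>x. inverse (h x)) has_derivative
        (\<lambda>v. (- 1) * (inverse (h x) * frechet_derivative h (at x) v * inverse (h x)))) (at x)"
      if "x \<in> S" for x
      using Deriv.has_derivative_inverse[OF assms(3)[OF that] Ck_on_derivative[OF Suc.prems that]]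
      by simp
    show "Ck_on k S (\<lambda>x. (- 1) * (inverse (h x) * frechet_derivative h (at x) v * inverse (h x)))"
      for v
      using Suc.prems Suc.IH Ck_on_SucD[OF Suc.prems]
      by (intro Ck_on_mult Ck_on_const assms(1)) (simp_all only: Ck_on.simps)
  qed
qed

lemma Ck_on_sum:
  fixes h :: "'i \<Rightarrow> 'a::real_normed_vector \<Rightarrow> 'b::real_normed_vector"
  assumes "open S" "\<And>i. i \<in> I \<Longrightarrow> Ck_on k S (h i)"
  shows "Ck_on k S (\<lambda>x. \<Sum>i\<in>I. h i x)"
  using assms(2)
  by (induction I rule: infinite_finite_induct) (auto intro!: Ck_on_const Ck_on_add assms(1))

text \<open>The derivative of \<open>l \<circ> h\<close> in direction \<open>v\<close> is expanded in the standard basis of the middle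
  space: only then is it a finite sum of products of functions of class \<open>k\<close>, to which the
  induction hypothesis for the partial derivatives of \<open>l\<close> applies.\<close>

lemma Ck_on_compose:
  fixes h :: "'a::real_normed_vector \<Rightarrow> 'b::euclidean_space" and l :: "'b \<Rightarrow> real"
  assumes "open S" "Ck_on k S h" "Ck_on k T l" "h ` S \<subseteq> T"
  shows "Ck_on k S (\<lambda>x. l (h x))"
  using assms(2,3)
proof (induction k arbitrary: l)
  case 0 then show ?case using continuous_on_compose2 assms(4) by auto
next
  case (Suc k)
  let ?D = "\<lambda>x v. \<Sum>b\<in>Basis. (frechet_derivative h (at x) v \<bullet> b) * frechet_derivative l (at (h x)) b"
  show ?case
  proof (rule Ck_on_Suc_if[OF assms(1), where D="?D"])
    show "((\<lambda>x. l (h x)) has_derivative ?D x) (at x)" if x: "x \<in> S" for x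
    proof -
      have l: "(l has_derivative frechet_derivative l (at (h x))) (at (h x))"
        using Ck_on_derivative[OF Suc.prems(2)] assms(4) x by blast
      have lin: "linear (frechet_derivative l (at (h x)))"
        using l has_derivative_linear by blast
      have expand: "frechet_derivative l (at (h x)) w =
          (\<Sum>b\<in>Basis. (w \<bullet> b) * frechet_derivative l (at (h x)) b)" for w
      proof -
        have "frechet_derivative l (at (h x)) w =
            frechet_derivative l (at (h x)) (\<Sum>b\<in>Basis. (w \<bullet> b) *\<^sub>R b)"
          by (simp add: euclidean_representation)
        also have "\<dots> = (\<Sum>b\<in>Basis. (w \<bullet> b) * frechet_derivative l (at (h x)) b)"
          using lin by (simp add: linear_sum linear_scale)
        finally show ?thesis .
      qed
      have "(\<lambda>v. frechet_derivative l (at (h x)) (frechet_derivative h (at x) v)) = ?D x"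
        by (rule ext, rule expand)
      with has_derivative_compose[OF Ck_on_derivative[OF Suc.prems(1) x] l] show ?thesis
        by (rule has_derivative_eq_rhs)
    qed
    show "Ck_on k S (\<lambda>x. ?D x v)" for v
    proof (intro Ck_on_sum Ck_on_mult assms(1))
      fix b :: 'b
      show "Ck_on k S (\<lambda>x. frechet_derivative h (at x) v \<bullet> b)"
        by (rule Ck_on_linear_compose[OF assms(1) bounded_linear_inner_left])
           (use Suc.prems in simp)
      show "Ck_on k S (\<lambda>x. frechet_derivative l (at (h x)) b)"
        by (rule Suc.IH[OF Ck_on_SucD[OF Suc.prems(1)]]) (use Suc.prems(2) in simp)
    qed
  qed
qed

lemma Cinf_on_differentiable:
  assumes "Cinf_on S h" "x \<in> S"
  shows "(h has_derivative frechet_derivative h (at x)) (at x)"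
  using assms Ck_on_derivative[of 0] unfolding Cinf_on_def by blast

lemma Cinf_on_directional_derivative:
  "Cinf_on S h \<Longrightarrow> Cinf_on S (\<lambda>x. frechet_derivative h (at x) v)"
  unfolding Cinf_on_def by (metis Ck_on.simps(2))

lemma Cinf_on_cong: "Cinf_on S h \<Longrightarrow> (\<And>x. x \<in> S \<Longrightarrow> h x = l x) \<Longrightarrow> Cinf_on S l"
  unfolding Cinf_on_def using Ck_on_cong by blast

lemma Cinf_on_subset: "Cinf_on S h \<Longrightarrow> open T \<Longrightarrow> T \<subseteq> S \<Longrightarrow> Cinf_on T h"
  unfolding Cinf_on_def using Ck_on_subset by blast

lemma Cinf_on_compose:
  fixes h :: "'a::real_normed_vector \<Rightarrow> 'b::euclidean_space" and l :: "'b \<Rightarrow> real"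
  shows "Cinf_on S h \<Longrightarrow> Cinf_on T l \<Longrightarrow> h ` S \<subseteq> T \<Longrightarrow> Cinf_on S (\<lambda>x. l (h x))"
  unfolding Cinf_on_def using Ck_on_compose by blast


section \<open>Charts, smooth functions and tangent vectors\<close>

text \<open>These are the functionals that make up the tangent space.  For a fixed \<open>w\<close> and varying point
  they form a coordinate vector field.\<close>

definition coord_vec ::
    "('a, 'n::finite) mfd \<Rightarrow> 'a set \<Rightarrow> ('a \<Rightarrow> real ^ 'n) \<Rightarrow> 'a \<Rightarrow> real ^ 'n \<Rightarrow> 'a tvec" where
  "coord_vec M U \<phi> p w = (\<lambda>u. if smooth_near M p u
     then frechet_derivative (u \<circ> inv_into U \<phi>) (at (\<phi> p)) w else 0)"

locale smooth_mfd =
  fixes M :: "('a, 'n::finite) mfd"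
  assumes mfd: "smooth_manifold M"
begin

lemma chartD:
  assumes "(U, \<phi>) \<in> charts M"
  shows "openin (mtop M) U" "open (\<phi> ` U)"
    "homeomorphic_map (subtopology (mtop M) U) (top_of_set (\<phi> ` U)) \<phi>"
    "U \<subseteq> pts M" "inj_on \<phi> U"
proof -
  show op: "openin (mtop M) U" "open (\<phi> ` U)"
    and hom: "homeomorphic_map (subtopology (mtop M) U) (top_of_set (\<phi> ` U)) \<phi>"
    using mfd assms unfolding smooth_manifold_def by auto
  show sub: "U \<subseteq> pts M" using op(1) openin_subset by blast
  have "topspace (subtopology (mtop M) U) = U" using sub by auto
  then show "inj_on \<phi> U" using homeomorphic_imp_injective_map[OF hom] by metis
qed

lemma transition_smooth:
  "(U, \<phi>) \<in> charts M \<Longrightarrow> (V, \<psi>) \<in> charts M \<Longrightarrow> Cinf_on (\<phi> ` (U \<inter> V)) (\<psi> \<circ> inv_into U \<phi>)"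
  using mfd unfolding smooth_manifold_def by blast

lemma chart_at:
  assumes "p \<in> pts M"
  obtains U \<phi> where "(U, \<phi>) \<in> charts M" "p \<in> U"
proof -
  have "p \<in> (\<Union>(U, \<phi>)\<in>charts M. U)" using mfd assms unfolding smooth_manifold_def by simp
  then show ?thesis using that by auto
qed

lemma chart_image_open:
  assumes "(U, \<phi>) \<in> charts M" "openin (mtop M) W"
  shows "open (\<phi> ` (U \<inter> W))"
proof -
  have "openin (subtopology (mtop M) U) (U \<inter> W)"
    using assms(2) by (simp add: openin_subtopology_Int2)
  then have "openin (top_of_set (\<phi> ` U)) (\<phi> ` (U \<inter> W))"
    using homeomorphic_imp_open_map[OF chartD(3)[OF assms(1)]] unfolding open_map_def by blast
  then show ?thesis using chartD(2)[OF assms(1)] openin_open_eq by blast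
qed

lemma inv_chart: "(U, \<phi>) \<in> charts M \<Longrightarrow> q \<in> U \<Longrightarrow> inv_into U \<phi> (\<phi> q) = q"
  using chartD(5) by (simp add: inv_into_f_f)

lemma smooth_fun_openin: "smooth_fun M W u \<Longrightarrow> openin (mtop M) W"
  by (simp add: smooth_fun_def)

lemma smooth_fun_chart:
  "smooth_fun M W u \<Longrightarrow> (U, \<phi>) \<in> charts M \<Longrightarrow> Cinf_on (\<phi> ` (U \<inter> W)) (u \<circ> inv_into U \<phi>)"
  unfolding smooth_fun_def by blast

lemma smooth_funI:
  "openin (mtop M) W \<Longrightarrow>
    (\<And>U \<phi>. (U, \<phi>) \<in> charts M \<Longrightarrow> Cinf_on (\<phi> ` (U \<inter> W)) (u \<circ> inv_into U \<phi>)) \<Longrightarrow>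
    smooth_fun M W u"
  unfolding smooth_fun_def by blast

lemma smooth_fun_cong:
  assumes "smooth_fun M W u" "\<And>q. q \<in> W \<Longrightarrow> u q = v q"
  shows "smooth_fun M W v"
proof (rule smooth_funI)
  show "openin (mtop M) W" using assms(1) smooth_fun_openin by blast
  fix U \<phi> assume c: "(U, \<phi>) \<in> charts M"
  show "Cinf_on (\<phi> ` (U \<inter> W)) (v \<circ> inv_into U \<phi>)"
    by (rule Cinf_on_cong[OF smooth_fun_chart[OF assms(1) c]])
       (auto simp: inv_chart[OF c] assms(2))
qed

lemma smooth_fun_subset:
  assumes "smooth_fun M W u" "openin (mtop M) V" "V \<subseteq> W"
  shows "smooth_fun M V u"
proof (rule smooth_funI[OF assms(2)])
  fix U \<phi> assume c: "(U, \<phi>) \<in> charts M"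
  show "Cinf_on (\<phi> ` (U \<inter> V)) (u \<circ> inv_into U \<phi>)"
    by (rule Cinf_on_subset[OF smooth_fun_chart[OF assms(1) c] chart_image_open[OF c assms(2)]])
       (use assms(3) in auto)
qed

lemma smooth_fun_local:
  assumes W: "openin (mtop M) W"
    and loc: "\<And>q. q \<in> W \<Longrightarrow> \<exists>V. q \<in> V \<and> smooth_fun M V u"
  shows "smooth_fun M W u"
proof (rule smooth_funI[OF W])
  fix U \<phi> assume c: "(U, \<phi>) \<in> charts M"
  have "\<exists>T. open T \<and> x \<in> T \<and> Ck_on k T (u \<circ> inv_into U \<phi>)" if x: "x \<in> \<phi> ` (U \<inter> W)" for x k
  proof -
    obtain q where q: "q \<in> U" "q \<in> W" "x = \<phi> q" using x by auto
    then obtain V where V: "q \<in> V" "smooth_fun M V u" using loc by blast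
    then show ?thesis
      using smooth_fun_chart[OF V(2) c] q
      by (intro exI[of _ "\<phi> ` (U \<inter> V)"]) (auto simp: Cinf_on_def)
  qed
  then show "Cinf_on (\<phi> ` (U \<inter> W)) (u \<circ> inv_into U \<phi>)"
    unfolding Cinf_on_def using chart_image_open[OF c W] Ck_on_local by blast
qed

lemma smooth_fun_const: "openin (mtop M) W \<Longrightarrow> smooth_fun M W (\<lambda>_. c)"
  by (rule smooth_funI) (auto simp: Cinf_on_def comp_def chart_image_open Ck_on_const)

lemma smooth_fun_add:
  assumes "smooth_fun M W u" "smooth_fun M W v"
  shows "smooth_fun M W (\<lambda>q. u q + v q)"
  using assms smooth_fun_chart[OF assms(1)] smooth_fun_chart[OF assms(2)] smooth_fun_openin
  by (intro smooth_funI) (auto simp: Cinf_on_def comp_def intro!: Ck_on_add)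

lemma smooth_fun_mult:
  assumes "smooth_fun M W u" "smooth_fun M W v"
  shows "smooth_fun M W (\<lambda>q. u q * v q)"
  using assms smooth_fun_chart[OF assms(1)] smooth_fun_chart[OF assms(2)] smooth_fun_openin
  by (intro smooth_funI) (auto simp: Cinf_on_def comp_def intro!: Ck_on_mult)

lemma smooth_fun_inverse:
  assumes "smooth_fun M W u" "\<And>q. q \<in> W \<Longrightarrow> u q \<noteq> 0"
  shows "smooth_fun M W (\<lambda>q. inverse (u q))"
proof (rule smooth_funI)
  show "openin (mtop M) W" using assms(1) smooth_fun_openin by blast
  fix U \<phi> assume c: "(U, \<phi>) \<in> charts M"
  have "u (inv_into U \<phi> x) \<noteq> 0" if "x \<in> \<phi> ` (U \<inter> W)" for x
    using that assms(2) inv_chart[OF c] by auto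
  with smooth_fun_chart[OF assms(1) c]
  show "Cinf_on (\<phi> ` (U \<inter> W)) ((\<lambda>q. inverse (u q)) \<circ> inv_into U \<phi>)"
    by (auto simp: Cinf_on_def comp_def intro!: Ck_on_inverse)
qed

lemma smooth_fun_divide:
  assumes "smooth_fun M W u" "smooth_fun M W v" "\<And>q. q \<in> W \<Longrightarrow> v q \<noteq> 0"
  shows "smooth_fun M W (\<lambda>q. u q / v q)"
  using smooth_fun_mult[OF assms(1) smooth_fun_inverse[OF assms(2,3)]]
  by (simp add: divide_inverse)

lemma smooth_fun_sum:
  assumes "openin (mtop M) W" "\<And>i. i \<in> I \<Longrightarrow> smooth_fun M W (u i)"
  shows "smooth_fun M W (\<lambda>q. \<Sum>i\<in>I. u i q)"
  using assms(2)
  by (induction I rule: infinite_finite_induct)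
     (auto intro!: smooth_fun_const smooth_fun_add assms(1))

text \<open>Smoothness in one chart suffices, because the transition maps carry it to all the others.\<close>

lemma smooth_fun_of_chart:
  assumes c: "(U, \<phi>) \<in> charts M" and V: "openin (mtop M) V" "V \<subseteq> U" and h: "Cinf_on (\<phi> ` V) h"
  shows "smooth_fun M V (\<lambda>q. h (\<phi> q))"
proof (rule smooth_funI[OF V(1)])
  fix U' \<psi> assume c': "(U', \<psi>) \<in> charts M"
  have "Cinf_on (\<psi> ` (U' \<inter> V)) (\<phi> \<circ> inv_into U' \<psi>)"
    by (rule Cinf_on_subset[OF transition_smooth[OF c' c] chart_image_open[OF c' V(1)]])
       (use V(2) in auto)
  moreover have "(\<phi> \<circ> inv_into U' \<psi>) ` (\<psi> ` (U' \<inter> V)) \<subseteq> \<phi> ` V"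
    using inv_chart[OF c'] by auto
  ultimately show "Cinf_on (\<psi> ` (U' \<inter> V)) ((\<lambda>q. h (\<phi> q)) \<circ> inv_into U' \<psi>)"
    using Cinf_on_compose[OF _ h] by (simp add: comp_def)
qed

lemma smooth_nearI: "smooth_fun M W u \<Longrightarrow> p \<in> W \<Longrightarrow> smooth_near M p u"
  unfolding smooth_near_def by blast

lemma smooth_near_has_derivative:
  assumes c: "(U, \<phi>) \<in> charts M" "p \<in> U" and u: "smooth_near M p u"
  shows "((u \<circ> inv_into U \<phi>) has_derivative
    frechet_derivative (u \<circ> inv_into U \<phi>) (at (\<phi> p))) (at (\<phi> p))"
proof -
  obtain W where "p \<in> W" "smooth_fun M W u" using u unfolding smooth_near_def by blast
  with smooth_fun_chart[OF _ c(1)] c(2) show ?thesis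
    by (intro Cinf_on_differentiable[of "\<phi> ` (U \<inter> W)"]) auto
qed

lemma coord_vec_comb:
  assumes c: "(U, \<phi>) \<in> charts M" "p \<in> U"
  shows "coord_vec M U \<phi> p (\<Sum>i\<in>I. a i *\<^sub>R w i) = (\<lambda>u. \<Sum>i\<in>I. a i * coord_vec M U \<phi> p (w i) u)"
proof
  fix u
  show "coord_vec M U \<phi> p (\<Sum>i\<in>I. a i *\<^sub>R w i) u = (\<Sum>i\<in>I. a i * coord_vec M U \<phi> p (w i) u)"
  proof (cases "smooth_near M p u")
    case True
    have "linear (frechet_derivative (u \<circ> inv_into U \<phi>) (at (\<phi> p)))"
      using smooth_near_has_derivative[OF c True] has_derivative_linear by blast
    with True show ?thesis by (simp add: coord_vec_def linear_sum linear_scale)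
  qed (simp add: coord_vec_def)
qed

text \<open>The chain rule for the transition map; it shows that a single chart describes the whole tangent
  space, which is therefore closed under linear combinations.\<close>

lemma coord_vec_transition:
  assumes c: "(U, \<phi>) \<in> charts M" "p \<in> U" and c': "(V, \<psi>) \<in> charts M" "p \<in> V"
  shows "coord_vec M V \<psi> p w =
    coord_vec M U \<phi> p (frechet_derivative (\<phi> \<circ> inv_into V \<psi>) (at (\<psi> p)) w)"
proof
  fix u
  let ?t = "\<phi> \<circ> inv_into V \<psi>"
  show "coord_vec M V \<psi> p w u = coord_vec M U \<phi> p (frechet_derivative ?t (at (\<psi> p)) w) u"
  proof (cases "smooth_near M p u")
    case True
    let ?S = "\<psi> ` (V \<inter> U)"
    have S: "open ?S" "\<psi> p \<in> ?S" using chart_image_open[OF c'(1) chartD(1)[OF c(1)]] c c' by auto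
    have "(?t has_derivative frechet_derivative ?t (at (\<psi> p))) (at (\<psi> p))"
      by (rule Cinf_on_differentiable[OF transition_smooth[OF c'(1) c(1)] S(2)])
    moreover have "?t (\<psi> p) = \<phi> p" using inv_chart[OF c'] by simp
    ultimately have "((\<lambda>x. (u \<circ> inv_into U \<phi>) (?t x)) has_derivative
        (\<lambda>x. frechet_derivative (u \<circ> inv_into U \<phi>) (at (\<phi> p)) (frechet_derivative ?t (at (\<psi> p)) x)))
        (at (\<psi> p))"
      using has_derivative_compose smooth_near_has_derivative[OF c True] by metis
    then have "((u \<circ> inv_into V \<psi>) has_derivative
        (\<lambda>x. frechet_derivative (u \<circ> inv_into U \<phi>) (at (\<phi> p)) (frechet_derivative ?t (at (\<psi> p)) x)))
        (at (\<psi> p))"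
      by (rule has_derivative_transform_within_open[OF _ S])
         (auto simp: inv_chart[OF c'(1)] inv_chart[OF c(1)])
    from frechet_derivative_at[OF this, symmetric] True show ?thesis by (simp add: coord_vec_def)
  qed (simp add: coord_vec_def)
qed

lemma tangent_space_eq_range:
  assumes c: "(U, \<phi>) \<in> charts M" "p \<in> U"
  shows "tangent_space M p = range (coord_vec M U \<phi> p)"
proof
  show "range (coord_vec M U \<phi> p) \<subseteq> tangent_space M p"
    using c unfolding tangent_space_def coord_vec_def by blast
  show "tangent_space M p \<subseteq> range (coord_vec M U \<phi> p)"
  proof
    fix v assume "v \<in> tangent_space M p"
    then obtain V \<psi> w where "(V, \<psi>) \<in> charts M" "p \<in> V" "v = coord_vec M V \<psi> p w"
      unfolding tangent_space_def coord_vec_def by blast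
    then show "v \<in> range (coord_vec M U \<phi> p)" using coord_vec_transition[OF c] by auto
  qed
qed

text \<open>The smooth function \<open>\<phi> \<bullet> w\<close> has derivative \<open>w \<bullet> w\<close> along \<open>w\<close>, so it detects every nonzero
  \<open>w\<close>.  Hence the tangent space has the full dimension \<open>CARD('n)\<close>.\<close>

lemma coord_vec_eq_0:
  assumes c: "(U, \<phi>) \<in> charts M" "p \<in> U" and 0: "coord_vec M U \<phi> p w = (\<lambda>_. 0)"
  shows "w = 0"
proof -
  have bl: "bounded_linear (\<lambda>x. x \<bullet> w)" by (rule bounded_linear_inner_left)
  have "Cinf_on (\<phi> ` U) (\<lambda>x. x \<bullet> w)"
    unfolding Cinf_on_def using chartD(2)[OF c(1)] Ck_on_bounded_linear[OF _ bl] by blast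
  then have sm: "smooth_near M p (\<lambda>q. \<phi> q \<bullet> w)"
    using smooth_fun_of_chart[OF c(1) chartD(1)[OF c(1)]] smooth_nearI c(2) by blast
  have "((\<lambda>x. x \<bullet> w) has_derivative (\<lambda>x. x \<bullet> w)) (at (\<phi> p))"
    by (rule bounded_linear_imp_has_derivative[OF bl])
  then have "(((\<lambda>q. \<phi> q \<bullet> w) \<circ> inv_into U \<phi>) has_derivative (\<lambda>x. x \<bullet> w)) (at (\<phi> p))"
    by (rule has_derivative_transform_within_open[OF _ chartD(2)[OF c(1)]])
       (use c(2) inv_chart[OF c(1)] in auto)
  from frechet_derivative_at[OF this, symmetric]
  have "coord_vec M U \<phi> p w (\<lambda>q. \<phi> q \<bullet> w) = w \<bullet> w" using sm by (simp add: coord_vec_def)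
  with 0 show ?thesis by simp
qed

lemma tangent_comb:
  assumes "p \<in> pts M" "\<And>i. i \<in> I \<Longrightarrow> v i \<in> tangent_space M p"
  shows "(\<lambda>u. \<Sum>i\<in>I. a i * v i u) \<in> tangent_space M p"
proof -
  obtain U \<phi> where c: "(U, \<phi>) \<in> charts M" "p \<in> U" using chart_at[OF assms(1)] .
  have "\<forall>i\<in>I. \<exists>w. v i = coord_vec M U \<phi> p w"
    using assms(2) tangent_space_eq_range[OF c] by auto
  then obtain w where "\<And>i. i \<in> I \<Longrightarrow> v i = coord_vec M U \<phi> p (w i)" by metis
  then have "(\<lambda>u. \<Sum>i\<in>I. a i * v i u) = coord_vec M U \<phi> p (\<Sum>i\<in>I. a i *\<^sub>R w i)"
    by (simp add: coord_vec_comb[OF c] cong: sum.cong)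
  then show ?thesis using tangent_space_eq_range[OF c] by simp
qed

lemma tangent_lin:
  assumes "p \<in> pts M" "v \<in> tangent_space M p" "w \<in> tangent_space M p"
  shows "(\<lambda>u. a * v u + b * w u) \<in> tangent_space M p"
  using tangent_comb[OF assms(1), of UNIV "case_bool v w" "case_bool a b"] assms(2,3)
  by (simp add: UNIV_bool add.commute split: bool.split)

lemma tangent_scale:
  assumes "p \<in> pts M" "v \<in> tangent_space M p"
  shows "(\<lambda>u. a * v u) \<in> tangent_space M p"
  using tangent_lin[OF assms assms(2), of a 0] by simp

lemma tangent_cong:
  assumes v: "v \<in> tangent_space M p" and u: "smooth_fun M W u" "p \<in> W" "\<And>q. q \<in> W \<Longrightarrow> u q = u' q"
  shows "v u = v u'"
proof -
  have "p \<in> pts M" using u openin_subset smooth_fun_openin by blast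
  then obtain U \<phi> where c: "(U, \<phi>) \<in> charts M" "p \<in> U" using chart_at by blast
  obtain w where w: "v = coord_vec M U \<phi> p w" using v tangent_space_eq_range[OF c] by auto
  have near: "smooth_near M p u" "smooth_near M p u'"
    using smooth_nearI[OF u(1,2)] smooth_nearI[OF smooth_fun_cong[OF u(1,3)] u(2)] by auto
  have "frechet_derivative (u' \<circ> inv_into U \<phi>) (at (\<phi> p)) = frechet_derivative (u \<circ> inv_into U \<phi>) (at (\<phi> p))"
  proof (rule frechet_derivative_transform_open(2))
    show "open (\<phi> ` (U \<inter> W))" by (rule chart_image_open[OF c(1) smooth_fun_openin[OF u(1)]])
    show "\<phi> p \<in> \<phi> ` (U \<inter> W)" using c u by auto
    show "(u \<circ> inv_into U \<phi>) y = (u' \<circ> inv_into U \<phi>) y" if "y \<in> \<phi> ` (U \<inter> W)" for y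
      using that inv_chart[OF c(1)] u(3) by auto
    show "u \<circ> inv_into U \<phi> differentiable at (\<phi> p)"
      using smooth_near_has_derivative[OF c near(1)] by (auto simp: differentiable_def)
  qed
  with near show ?thesis unfolding w by (simp add: coord_vec_def)
qed

lemma tangent_add:
  assumes v: "v \<in> tangent_space M p" and a: "smooth_fun M W a" and b: "smooth_fun M W b" and p: "p \<in> W"
  shows "v (\<lambda>q. a q + b q) = v a + v b"
proof -
  have "p \<in> pts M" using a p openin_subset smooth_fun_openin by blast
  then obtain U \<phi> where c: "(U, \<phi>) \<in> charts M" "p \<in> U" using chart_at by blast
  obtain w where w: "v = coord_vec M U \<phi> p w" using v tangent_space_eq_range[OF c] by auto
  have near: "smooth_near M p a" "smooth_near M p b" "smooth_near M p (\<lambda>q. a q + b q)"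
    using smooth_nearI a b p smooth_fun_add by blast+
  from has_derivative_add[OF smooth_near_has_derivative[OF c near(1)]
      smooth_near_has_derivative[OF c near(2)], THEN frechet_derivative_at, symmetric] near
  show ?thesis unfolding w by (simp add: coord_vec_def comp_def)
qed

lemma tangent_mult:
  assumes v: "v \<in> tangent_space M p" and a: "smooth_fun M W a" and b: "smooth_fun M W b" and p: "p \<in> W"
  shows "v (\<lambda>q. a q * b q) = a p * v b + v a * b p"
proof -
  have "p \<in> pts M" using a p openin_subset smooth_fun_openin by blast
  then obtain U \<phi> where c: "(U, \<phi>) \<in> charts M" "p \<in> U" using chart_at by blast
  obtain w where w: "v = coord_vec M U \<phi> p w" using v tangent_space_eq_range[OF c] by auto
  have near: "smooth_near M p a" "smooth_near M p b" "smooth_near M p (\<lambda>q. a q * b q)"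
    using smooth_nearI a b p smooth_fun_mult by blast+
  from has_derivative_mult[OF smooth_near_has_derivative[OF c near(1)]
      smooth_near_has_derivative[OF c near(2)], THEN frechet_derivative_at, symmetric] near
  show ?thesis unfolding w by (simp add: coord_vec_def comp_def inv_chart[OF c])
qed

lemma tangent_const:
  assumes v: "v \<in> tangent_space M p" and p: "p \<in> pts M"
  shows "v (\<lambda>_. c) = 0"
proof -
  obtain U \<phi> where ch: "(U, \<phi>) \<in> charts M" "p \<in> U" using chart_at[OF p] .
  obtain w where "v = coord_vec M U \<phi> p w" using v tangent_space_eq_range[OF ch] by auto
  then show ?thesis by (simp add: coord_vec_def comp_def)
qed

lemma tangent_cmult:
  assumes v: "v \<in> tangent_space M p" and a: "smooth_fun M W a" and p: "p \<in> W"
  shows "v (\<lambda>q. c * a q) = c * v a"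
proof -
  have "p \<in> pts M" using a p openin_subset smooth_fun_openin by blast
  then show ?thesis
    using tangent_mult[OF v smooth_fun_const[OF smooth_fun_openin[OF a]] a p] tangent_const[OF v]
    by simp
qed

lemma tangent_diff:
  assumes v: "v \<in> tangent_space M p" and a: "smooth_fun M W a" and b: "smooth_fun M W b" and p: "p \<in> W"
  shows "v (\<lambda>q. a q - b q) = v a - v b"
  using tangent_add[OF v a smooth_fun_mult[OF smooth_fun_const b] p, of "- 1"]
    tangent_cmult[OF v b p, of "- 1"] smooth_fun_openin[OF a] by simp

lemma smooth_field_openin: "smooth_field M W X \<Longrightarrow> openin (mtop M) W"
  by (simp add: smooth_field_def)

lemma smooth_field_tangent: "smooth_field M W X \<Longrightarrow> q \<in> W \<Longrightarrow> X q \<in> tangent_space M q"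
  by (simp add: smooth_field_def)

lemma smooth_field_apply:
  "smooth_field M W X \<Longrightarrow> smooth_fun M W u \<Longrightarrow> smooth_fun M W (\<lambda>q. X q u)"
  by (simp add: smooth_field_def)

lemma smooth_field_subset:
  "smooth_field M W X \<Longrightarrow> openin (mtop M) V \<Longrightarrow> V \<subseteq> W \<Longrightarrow> smooth_field M V X"
  unfolding smooth_field_def by blast

lemma smooth_field_cong:
  assumes "smooth_field M W X" "\<And>q. q \<in> W \<Longrightarrow> X q = Y q"
  shows "smooth_field M W Y"
proof -
  have "smooth_fun M V (\<lambda>q. Y q u)" if "V \<subseteq> W" "smooth_fun M V u" for V u
  proof (rule smooth_fun_cong)
    show "smooth_fun M V (\<lambda>q. X q u)" using assms(1) that unfolding smooth_field_def by blast
  qed (use assms(2) that in auto)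
  moreover have "Y q \<in> tangent_space M q" if "q \<in> W" for q
    using smooth_field_tangent[OF assms(1) that] assms(2)[OF that] by simp
  ultimately show ?thesis
    using smooth_field_openin[OF assms(1)] unfolding smooth_field_def by blast
qed

lemma smooth_field_local:
  assumes W: "openin (mtop M) W"
    and loc: "\<And>q. q \<in> W \<Longrightarrow> \<exists>V. q \<in> V \<and> smooth_field M V X"
  shows "smooth_field M W X"
  unfolding smooth_field_def
proof (intro conjI ballI allI impI W)
  show "X q \<in> tangent_space M q" if "q \<in> W" for q
    using loc[OF that] smooth_field_tangent by blast
  fix V u assume Vu: "V \<subseteq> W \<and> smooth_fun M V u"
  then have V: "openin (mtop M) V" using smooth_fun_openin by blast
  show "smooth_fun M V (\<lambda>q. X q u)"
  proof (rule smooth_fun_local[OF V])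
    fix q assume q: "q \<in> V"
    then obtain V' where V': "q \<in> V'" "smooth_field M V' X" using loc Vu by blast
    have "openin (mtop M) (V \<inter> V')" using V smooth_field_openin[OF V'(2)] by blast
    then have "smooth_fun M (V \<inter> V') (\<lambda>q. X q u)"
      using smooth_field_apply[OF smooth_field_subset[OF V'(2)] smooth_fun_subset] Vu by auto
    then show "\<exists>V'. q \<in> V' \<and> smooth_fun M V' (\<lambda>q. X q u)" using q V'(1) by blast
  qed
qed

lemma smooth_field_comb:
  assumes W: "openin (mtop M) W"
    and "\<And>i. i \<in> I \<Longrightarrow> smooth_fun M W (a i)" "\<And>i. i \<in> I \<Longrightarrow> smooth_field M W (X i)"
  shows "smooth_field M W (\<lambda>q u. \<Sum>i\<in>I. a i q * X i q u)"
  unfolding smooth_field_def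
proof (intro conjI ballI allI impI W)
  show "(\<lambda>u. \<Sum>i\<in>I. a i q * X i q u) \<in> tangent_space M q" if "q \<in> W" for q
    using that openin_subset[OF W] by (intro tangent_comb smooth_field_tangent[OF assms(3)]) auto
  fix V u assume Vu: "V \<subseteq> W \<and> smooth_fun M V u"
  then have V: "openin (mtop M) V" using smooth_fun_openin by blast
  show "smooth_fun M V (\<lambda>q. \<Sum>i\<in>I. a i q * X i q u)"
  proof (rule smooth_fun_sum[OF V], rule smooth_fun_mult)
    fix i assume i: "i \<in> I"
    show "smooth_fun M V (a i)" using smooth_fun_subset[OF assms(2)[OF i] V] Vu by simp
    show "smooth_fun M V (\<lambda>q. X i q u)"
      using smooth_field_apply[OF smooth_field_subset[OF assms(3)[OF i] V]] Vu by simp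
  qed
qed

lemma smooth_field_mult:
  "smooth_fun M W h \<Longrightarrow> smooth_field M W X \<Longrightarrow> smooth_field M W (field_mult h X)"
  using smooth_field_comb[of W UNIV "\<lambda>_::unit. h" "\<lambda>_. X"] smooth_fun_openin
  by (simp add: field_mult_def UNIV_unit)

lemma smooth_field_add:
  assumes "smooth_field M W X" "smooth_field M W Y"
  shows "smooth_field M W (field_add X Y)"
  using smooth_field_comb[of W UNIV "\<lambda>_ _. 1" "case_bool X Y"] smooth_field_openin assms
  by (simp add: field_add_def UNIV_bool smooth_fun_const add.commute split: bool.split)

lemma coord_field_smooth:
  assumes c: "(U, \<phi>) \<in> charts M"
  shows "smooth_field M U (\<lambda>q. coord_vec M U \<phi> q w)"
  unfolding smooth_field_def
proof (intro conjI ballI allI impI)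
  show "openin (mtop M) U" using chartD[OF c] by blast
  show "coord_vec M U \<phi> q w \<in> tangent_space M q" if "q \<in> U" for q
    using tangent_space_eq_range[OF c that] by blast
  fix V u assume Vu: "V \<subseteq> U \<and> smooth_fun M V u"
  then have "Cinf_on (\<phi> ` V) (u \<circ> inv_into U \<phi>)"
    using smooth_fun_chart[OF _ c, of V u] by (simp add: Int_absorb1)
  then have "smooth_fun M V (\<lambda>q. frechet_derivative (u \<circ> inv_into U \<phi>) (at (\<phi> q)) w)"
    using Vu smooth_fun_openin
      smooth_fun_of_chart[OF c, of V "\<lambda>x. frechet_derivative (u \<circ> inv_into U \<phi>) (at x) w"]
      Cinf_on_directional_derivative by blast
  then show "smooth_fun M V (\<lambda>q. coord_vec M U \<phi> q w u)"
    by (rule smooth_fun_cong) (use Vu smooth_nearI in \<open>auto simp: coord_vec_def\<close>)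
qed

lemma tangent_extend:
  assumes p: "p \<in> pts M" and v: "v \<in> tangent_space M p"
  obtains V Z where "p \<in> V" "smooth_field M V Z" "Z p = v"
proof -
  obtain U \<phi> where c: "(U, \<phi>) \<in> charts M" "p \<in> U" using chart_at[OF p] .
  obtain w where "v = coord_vec M U \<phi> p w" using v tangent_space_eq_range[OF c] by auto
  then show ?thesis using that[OF c(2) coord_field_smooth[OF c(1)]] by simp
qed

end


section \<open>Orthogonal frames and gradients\<close>

locale riemannian_mfd = smooth_mfd M for M :: "('a, 'n::finite) mfd" +
  fixes g :: "'a metric"
  assumes metric: "riemannian_metric M g"
begin

lemma g_sym: "p \<in> pts M \<Longrightarrow> v \<in> tangent_space M p \<Longrightarrow> w \<in> tangent_space M p \<Longrightarrow> g p v w = g p w v"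
  using metric unfolding riemannian_metric_def by blast

lemma g_pos: "p \<in> pts M \<Longrightarrow> v \<in> tangent_space M p \<Longrightarrow> v \<noteq> (\<lambda>_. 0) \<Longrightarrow> g p v v > 0"
  using metric unfolding riemannian_metric_def by blast

lemma g_lin:
  "p \<in> pts M \<Longrightarrow> v \<in> tangent_space M p \<Longrightarrow> w \<in> tangent_space M p \<Longrightarrow> z \<in> tangent_space M p \<Longrightarrow>
    g p (\<lambda>u. a * v u + b * w u) z = a * g p v z + b * g p w z"
  using metric unfolding riemannian_metric_def by blast

lemma g_smooth:
  "smooth_field M W X \<Longrightarrow> smooth_field M W Y \<Longrightarrow> smooth_fun M W (\<lambda>q. g q (X q) (Y q))"
  using metric unfolding riemannian_metric_def by blast

lemma g_comb:
  assumes p: "p \<in> pts M" and z: "z \<in> tangent_space M p"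
    and v: "\<And>i. i \<in> I \<Longrightarrow> v i \<in> tangent_space M p"
  shows "g p (\<lambda>u. \<Sum>i\<in>I. a i * v i u) z = (\<Sum>i\<in>I. a i * g p (v i) z)"
proof -
  have 0: "g p (\<lambda>u. 0) z = 0" using g_lin[OF p z z z, of 0 0] by simp
  show ?thesis using v
  proof (induction I rule: infinite_finite_induct)
    case (insert i I)
    have "g p (\<lambda>u. a i * v i u + 1 * (\<Sum>i\<in>I. a i * v i u)) z =
        a i * g p (v i) z + 1 * g p (\<lambda>u. \<Sum>i\<in>I. a i * v i u) z"
      using insert.prems by (intro g_lin p z tangent_comb) auto
    with insert show ?case by simp
  qed (simp_all add: 0)
qed

lemma g_comb_right:
  assumes p: "p \<in> pts M" and z: "z \<in> tangent_space M p"
    and v: "\<And>i. i \<in> I \<Longrightarrow> v i \<in> tangent_space M p"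
  shows "g p z (\<lambda>u. \<Sum>i\<in>I. a i * v i u) = (\<Sum>i\<in>I. a i * g p z (v i))"
proof -
  have "g p z (\<lambda>u. \<Sum>i\<in>I. a i * v i u) = g p (\<lambda>u. \<Sum>i\<in>I. a i * v i u) z"
    by (rule g_sym[OF p z tangent_comb[OF p v]])
  also have "\<dots> = (\<Sum>i\<in>I. a i * g p (v i) z)" by (rule g_comb[OF p z v])
  also have "\<dots> = (\<Sum>i\<in>I. a i * g p z (v i))"
    by (intro sum.cong refl) (simp add: g_sym[OF p z v])
  finally show ?thesis .
qed

lemma g_scale:
  assumes "p \<in> pts M" "v \<in> tangent_space M p" "w \<in> tangent_space M p"
  shows "g p (\<lambda>u. a * v u) w = a * g p v w"
  using g_lin[OF assms(1,2,2,3), of a 0] by simp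

lemma g_scale_right:
  assumes "p \<in> pts M" "v \<in> tangent_space M p" "w \<in> tangent_space M p"
  shows "g p v (\<lambda>u. a * w u) = a * g p v w"
  using g_comb_right[OF assms(1,2), of "{()}" "\<lambda>_. w" "\<lambda>_. a"] assms(3) by simp

lemma tangent_eqI:
  assumes p: "p \<in> pts M" and v: "v \<in> tangent_space M p" and w: "w \<in> tangent_space M p"
    and eq: "\<And>z. z \<in> tangent_space M p \<Longrightarrow> g p v z = g p w z"
  shows "v = w"
proof -
  let ?d = "\<lambda>u. 1 * v u + (- 1) * w u"
  have d: "?d \<in> tangent_space M p" by (rule tangent_lin[OF p v w])
  have "g p ?d ?d = 0" using g_lin[OF p v w d, of 1 "- 1"] eq[OF d] by simp
  with g_pos[OF p d] have "?d = (\<lambda>_. 0)" by fastforce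
  then show ?thesis by (auto simp: fun_eq_iff)
qed

text \<open>As many orthogonal non-null vectors as the dimension span the tangent space: the combination map
  \<open>L\<close> from \<open>real ^ 'n\<close> to itself is injective by orthogonality, hence surjective.\<close>

lemma orthogonal_expansion:
  fixes e :: "'n \<Rightarrow> 'a tvec"
  assumes p: "p \<in> pts M" and e: "\<And>i. e i \<in> tangent_space M p"
    and orth: "\<And>i j. i \<noteq> j \<Longrightarrow> g p (e i) (e j) = 0" and nz: "\<And>i. g p (e i) (e i) \<noteq> 0"
    and v: "v \<in> tangent_space M p"
  shows "v = (\<lambda>u. \<Sum>i\<in>UNIV. g p v (e i) / g p (e i) (e i) * e i u)"
proof -
  obtain U \<phi> where c: "(U, \<phi>) \<in> charts M" "p \<in> U" using chart_at[OF p] .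
  have "\<forall>i. \<exists>w. e i = coord_vec M U \<phi> p w" using e tangent_space_eq_range[OF c] by auto
  then obtain w where w: "\<And>i. e i = coord_vec M U \<phi> p (w i)" by metis
  define L where "L = (\<lambda>a :: real ^ 'n. \<Sum>i\<in>UNIV. (a $ i) *\<^sub>R w i)"
  have L: "coord_vec M U \<phi> p (L a) = (\<lambda>u. \<Sum>i\<in>UNIV. a $ i * e i u)" for a
    unfolding L_def w by (rule coord_vec_comb[OF c])
  have coeff: "g p (\<lambda>u. \<Sum>i\<in>UNIV. a $ i * e i u) (e j) = a $ j * g p (e j) (e j)" for a :: "real ^ 'n" and j
  proof -
    have "(\<Sum>i\<in>UNIV. a $ i * g p (e i) (e j)) = (\<Sum>i\<in>UNIV. if i = j then a $ j * g p (e j) (e j) else 0)"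
      by (intro sum.cong refl) (simp add: orth)
    then show ?thesis by (simp add: g_comb[OF p e e])
  qed
  have lin: "linear L"
    unfolding L_def by (intro linearI) (simp_all add: scaleR_add_left sum.distrib scaleR_sum_right)
  have "a = 0" if "L a = 0" for a
  proof -
    have "coord_vec M U \<phi> p (L a) = (\<lambda>_. 0)"
      using coord_vec_comb[OF c, of "\<lambda>_. 0" "\<lambda>_. 0" "{}"] that by simp
    then have "g p (\<lambda>u. \<Sum>i\<in>UNIV. a $ i * e i u) (e j) = 0" for j
      unfolding L using g_comb[OF p e[of j], of "{}"] by simp
    then show ?thesis unfolding coeff using nz by (simp add: vec_eq_iff)
  qed
  then have "inj L" using linear_injective_0[OF lin] by blast
  then have "surj L" by (rule linear_inj_imp_surj[OF lin])
  moreover obtain x where "v = coord_vec M U \<phi> p x" using v tangent_space_eq_range[OF c] by auto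
  ultimately obtain a where a: "v = (\<lambda>u. \<Sum>i\<in>UNIV. a $ i * e i u)" using L by (metis surj_def)
  have "g p v (e i) / g p (e i) (e i) = a $ i" for i unfolding a coeff using nz by simp
  then show ?thesis using a by simp
qed

text \<open>Orthogonalisation of the coordinate fields over a chart.  The fields are not normalised, so
  every coefficient is a quotient of smooth functions and no square roots arise.  The invariant that
  the coefficient vectors of the fields found so far vanish outside \<open>I\<close> forces the vector
  added for a new index to have coefficient \<open>1\<close> at that index, so that it vanishes nowhere.\<close>

lemma gram_schmidt:
  fixes I :: "'n set"
  assumes c: "(U, \<phi>) \<in> charts M" and "finite I"
  shows "\<exists>F a. (\<forall>i\<in>I. smooth_field M U (F i) \<and>
      (\<forall>q\<in>U. F i q = coord_vec M U \<phi> q (a i q) \<and> a i q \<noteq> 0 \<and> (\<forall>k. k \<notin> I \<longrightarrow> a i q $ k = 0))) \<and>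
      (\<forall>i\<in>I. \<forall>j\<in>I. i \<noteq> j \<longrightarrow> (\<forall>q\<in>U. g q (F i q) (F j q) = 0))"
  using assms(2)
proof (induction I rule: finite_induct)
  case (insert i I)
  from insert.IH obtain F a where Fa: "\<forall>i\<in>I. smooth_field M U (F i) \<and>
      (\<forall>q\<in>U. F i q = coord_vec M U \<phi> q (a i q) \<and> a i q \<noteq> 0 \<and> (\<forall>k. k \<notin> I \<longrightarrow> a i q $ k = 0))"
    "\<forall>i\<in>I. \<forall>j\<in>I. i \<noteq> j \<longrightarrow> (\<forall>q\<in>U. g q (F i q) (F j q) = 0)"
    by (elim exE conjE)
  have F: "\<And>j. j \<in> I \<Longrightarrow> smooth_field M U (F j)"
    and a: "\<And>j q. j \<in> I \<Longrightarrow> q \<in> U \<Longrightarrow> F j q = coord_vec M U \<phi> q (a j q)"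
      "\<And>j q. j \<in> I \<Longrightarrow> q \<in> U \<Longrightarrow> a j q \<noteq> 0"
      "\<And>j q k. j \<in> I \<Longrightarrow> q \<in> U \<Longrightarrow> k \<notin> I \<Longrightarrow> a j q $ k = 0"
    and orth: "\<And>j k q. j \<in> I \<Longrightarrow> k \<in> I \<Longrightarrow> j \<noteq> k \<Longrightarrow> q \<in> U \<Longrightarrow> g q (F j q) (F k q) = 0"
    using Fa by blast+
  have U: "openin (mtop M) U" "U \<subseteq> pts M" using chartD[OF c] by auto
  have pos: "g q (F j q) (F j q) > 0" if "j \<in> I" "q \<in> U" for j q
    using g_pos[of q "F j q"] a[OF that] coord_vec_eq_0[OF c that(2), of "a j q"]
      smooth_field_tangent[OF F[OF that(1)] that(2)] U that by auto
  define X where "X = (\<lambda>q. coord_vec M U \<phi> q (axis i 1))"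
  have X: "smooth_field M U X" unfolding X_def by (rule coord_field_smooth[OF c])
  define Y where "Y = F(i := X)"
  define y where "y = a(i := (\<lambda>_. axis i 1))"
  \<comment> \<open>the coefficients of the projection off the span of the previous fields; \<open>X\<close> itself has coefficient \<open>1\<close>\<close>
  define b where "b = (\<lambda>k q. if k = i then 1 else (- 1) * (g q (X q) (F k q) / g q (F k q) (F k q)))"
  have Y: "smooth_field M U (Y k)" if "k \<in> insert i I" for k
    using that F X by (auto simp: Y_def)
  have Yy: "Y k q = coord_vec M U \<phi> q (y k q)" if "k \<in> insert i I" "q \<in> U" for k q
    using that a(1) by (auto simp: Y_def y_def X_def)
  have b: "smooth_fun M U (b k)" if "k \<in> insert i I" for k
  proof (cases "k = i")
    case True then show ?thesis by (simp add: b_def smooth_fun_const U)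
  next
    case False
    with that have "k \<in> I" by simp
    then have "smooth_fun M U (\<lambda>q. (- 1) * (g q (X q) (F k q) / g q (F k q) (F k q)))"
      using pos by (intro smooth_fun_mult[OF smooth_fun_const] smooth_fun_divide g_smooth F X U)
        (auto simp: less_imp_neq[symmetric])
    with False show ?thesis by (simp add: b_def)
  qed
  define G where "G = (\<lambda>q u. \<Sum>k\<in>insert i I. b k q * Y k q u)"
  define d where "d = (\<lambda>q. \<Sum>k\<in>insert i I. b k q *\<^sub>R y k q)"
  have G: "smooth_field M U G" unfolding G_def by (rule smooth_field_comb[OF U(1) b Y])
  have Gd: "G q = coord_vec M U \<phi> q (d q)" if "q \<in> U" for q
    unfolding d_def coord_vec_comb[OF c that] G_def using Yy that by simp
  have "d q $ i = 1" if "q \<in> U" for q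
  proof -
    have "d q $ i = (\<Sum>k\<in>insert i I. if k = i then 1 else 0)"
      unfolding d_def sum_component
      by (intro sum.cong refl) (use insert.hyps a(3)[OF _ that] in \<open>auto simp: b_def y_def\<close>)
    then show ?thesis using insert.hyps by simp
  qed
  then have d0: "d q \<noteq> 0" if "q \<in> U" for q using that by (metis zero_index zero_neq_one)
  have dk: "d q $ k = 0" if "q \<in> U" "k \<notin> insert i I" for q k
    unfolding d_def sum_component
    by (intro sum.neutral ballI) (use that a(3)[OF _ that(1)] in \<open>auto simp: y_def axis_def\<close>)
  have Gorth: "g q (G q) (F j q) = 0" if "j \<in> I" "q \<in> U" for j q
  proof -
    have t: "F j q \<in> tangent_space M q" using smooth_field_tangent F that by blast
    have ij: "i \<noteq> j" using insert.hyps that by auto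
    have "g q (G q) (F j q) = (\<Sum>k\<in>insert i I. b k q * g q (Y k q) (F j q))"
      unfolding G_def using that U Y smooth_field_tangent by (intro g_comb t) blast+
    also have "\<dots> = b i q * g q (Y i q) (F j q) + (\<Sum>k\<in>I. b k q * g q (Y k q) (F j q))"
      using insert.hyps by simp
    also have "(\<Sum>k\<in>I. b k q * g q (Y k q) (F j q)) =
        (\<Sum>k\<in>I. if k = j then b j q * g q (F j q) (F j q) else 0)"
      using insert.hyps that orth by (intro sum.cong refl) (auto simp: Y_def)
    finally show ?thesis
      using insert.hyps that ij pos[OF that] by (simp add: b_def Y_def)
  qed
  have Gorth': "g q (F j q) (G q) = 0" if "j \<in> I" "q \<in> U" for j q
    using Gorth[OF that] g_sym smooth_field_tangent[OF G] smooth_field_tangent[OF F] that U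
    by (metis subsetD)
  show ?case
    by (rule exI[of _ "F(i := G)"], rule exI[of _ "a(i := d)"])
       (use insert.hyps F a orth G Gd d0 dk Gorth Gorth' in auto)
qed simp

lemma orthogonal_frame:
  assumes c: "(U, \<phi>) \<in> charts M"
  obtains F :: "'n \<Rightarrow> 'a vfield" where "\<And>i. smooth_field M U (F i)"
    "\<And>i j q. i \<noteq> j \<Longrightarrow> q \<in> U \<Longrightarrow> g q (F i q) (F j q) = 0"
    "\<And>i q. q \<in> U \<Longrightarrow> g q (F i q) (F i q) > 0"
proof -
  from gram_schmidt[OF c finite_class.finite_UNIV] obtain F :: "'n \<Rightarrow> 'a vfield" and a where
    Fa: "\<forall>i\<in>UNIV. smooth_field M U (F i) \<and>
      (\<forall>q\<in>U. F i q = coord_vec M U \<phi> q (a i q) \<and> a i q \<noteq> 0 \<and>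
        (\<forall>k. k \<notin> UNIV \<longrightarrow> a i q $ k = 0))"
    and orth: "\<forall>i\<in>UNIV. \<forall>j\<in>UNIV. i \<noteq> j \<longrightarrow> (\<forall>q\<in>U. g q (F i q) (F j q) = 0)"
    by (elim exE conjE)
  have F: "\<And>j. smooth_field M U (F j)"
    and a: "\<And>j q. q \<in> U \<Longrightarrow> F j q = coord_vec M U \<phi> q (a j q)"
      "\<And>j q. q \<in> U \<Longrightarrow> a j q \<noteq> 0"
    using Fa by blast+
  have "g q (F j q) (F j q) > 0" if "q \<in> U" for j q
    using g_pos[of q "F j q"] a[OF that] coord_vec_eq_0[OF c that, of "a j q"]
      smooth_field_tangent[OF F that] chartD(4)[OF c] that by auto
  then show ?thesis using F orth by (intro that[of F]) auto
qed

text \<open>The frame picked in the definitions of the traces does satisfy its specification: an orthogonal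
  frame is normalised by constants, which is enough for orthonormality at the one point \<open>p\<close>.\<close>

lemma some_frame_at:
  assumes p: "p \<in> pts M"
  shows "frame_at M g p (some_frame M g p)"
proof -
  obtain U \<phi> where c: "(U, \<phi>) \<in> charts M" "p \<in> U" using chart_at[OF p] .
  obtain F :: "'n \<Rightarrow> 'a vfield" where F: "\<And>i. smooth_field M U (F i)"
    and orth: "\<And>i j q. i \<noteq> j \<Longrightarrow> q \<in> U \<Longrightarrow> g q (F i q) (F j q) = 0"
    and pos: "\<And>i q. q \<in> U \<Longrightarrow> g q (F i q) (F i q) > 0" using orthogonal_frame[OF c(1)] by blast
  let ?r = "\<lambda>i. 1 / sqrt (g p (F i p) (F i p))"
  have t: "F i p \<in> tangent_space M p" for i using smooth_field_tangent F c by blast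
  have "g p (\<lambda>u. ?r i * F i p u) (\<lambda>u. ?r j * F j p u) = ?r i * (?r j * g p (F i p) (F j p))" for i j
    by (simp only: g_scale[OF p t tangent_scale[OF p t]] g_scale_right[OF p t t])
  moreover have "?r i * (?r j * g p (F i p) (F j p)) = (if i = j then 1 else 0)" for i j
    using orth[OF _ c(2), of i j] pos[OF c(2), of i] by (auto simp: field_simps)
  moreover have "smooth_field M U (field_mult (\<lambda>_. ?r i) (F i))" for i
    by (intro smooth_field_mult smooth_fun_const F chartD[OF c(1)])
  ultimately have "frame_at M g p (\<lambda>i. field_mult (\<lambda>_. ?r i) (F i))"
    unfolding frame_at_def field_mult_def using c(2) by auto
  then show ?thesis unfolding some_frame_def by (rule someI[of "frame_at M g p"])
qed

text \<open>The Riesz representation of \<open>dh\<close> at \<open>p\<close> in an orthogonal basis; it makes the definite description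
  in the definition of the gradient meaningful.\<close>

lemma grad_orthogonal:
  fixes e :: "'n \<Rightarrow> 'a tvec"
  assumes p: "p \<in> pts M" and e: "\<And>i. e i \<in> tangent_space M p"
    and orth: "\<And>i j. i \<noteq> j \<Longrightarrow> g p (e i) (e j) = 0" and nz: "\<And>i. g p (e i) (e i) \<noteq> 0"
  shows "grad M g h p = (\<lambda>u. \<Sum>i\<in>UNIV. e i h / g p (e i) (e i) * e i u)"
    and "grad M g h p \<in> tangent_space M p"
    and "w \<in> tangent_space M p \<Longrightarrow> g p (grad M g h p) w = w h"
proof -
  let ?v = "\<lambda>u. \<Sum>i\<in>UNIV. e i h / g p (e i) (e i) * e i u"
  have v: "?v \<in> tangent_space M p" by (rule tangent_comb[OF p e])
  have vw: "g p ?v w = w h" if w: "w \<in> tangent_space M p" for w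
  proof -
    have "g p ?v w = (\<Sum>i\<in>UNIV. e i h / g p (e i) (e i) * g p (e i) w)"
      by (rule g_comb[OF p w e])
    also have "\<dots> = (\<Sum>i\<in>UNIV. g p w (e i) / g p (e i) (e i) * e i h)"
      by (intro sum.cong refl) (simp add: g_sym[OF p w e])
    also have "\<dots> = w h" by (rule fun_cong[where x=h, OF orthogonal_expansion[OF assms w], symmetric])
    finally show ?thesis .
  qed
  show eq: "grad M g h p = ?v"
    unfolding grad_def
  proof (rule the_equality)
    fix v assume "v \<in> tangent_space M p \<and> (\<forall>w\<in>tangent_space M p. g p v w = w h)"
    then show "v = ?v" using vw by (intro tangent_eqI[OF p _ v]) auto
  qed (use v vw in blast)
  show "grad M g h p \<in> tangent_space M p" unfolding eq by (rule v)
  show "g p (grad M g h p) w = w h" if "w \<in> tangent_space M p" unfolding eq by (rule vw[OF that])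
qed

lemma frame_atD:
  assumes "frame_at M g p E"
  shows "p \<in> pts M" "E i p \<in> tangent_space M p" "g p (E i p) (E j p) = (if i = j then 1 else 0)"
  using assms smooth_field_tangent smooth_field_openin openin_subset
  unfolding frame_at_def by blast+

lemma grad_frame:
  assumes "frame_at M g p E"
  shows "(\<Sum>i\<in>UNIV. E i p h * E i p u) = grad M g h p u"
  using frame_atD[OF assms] by (subst grad_orthogonal(1)[where e="\<lambda>i. E i p"]) auto

lemma grad_at:
  assumes p: "p \<in> pts M"
  shows grad_tangent: "grad M g h p \<in> tangent_space M p"
    and g_grad: "w \<in> tangent_space M p \<Longrightarrow> g p (grad M g h p) w = w h"
  using frame_atD[OF some_frame_at[OF p]]
    grad_orthogonal(2,3)[OF p, of "\<lambda>i. some_frame M g p i p"] by auto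

lemma grad_eqI:
  assumes p: "p \<in> pts M" and "v \<in> tangent_space M p" "\<And>w. w \<in> tangent_space M p \<Longrightarrow> g p v w = w h"
  shows "grad M g h p = v"
  by (rule tangent_eqI[OF p grad_tangent[OF p] assms(2)]) (simp add: g_grad[OF p] assms(3))

text \<open>Near each point the gradient is a combination of a smooth orthogonal frame with smooth
  coefficients.\<close>

lemma grad_smooth:
  assumes h: "smooth_fun M W h"
  shows "smooth_field M W (grad M g h)"
proof (rule smooth_field_local)
  show W: "openin (mtop M) W" using h smooth_fun_openin by blast
  fix p assume p: "p \<in> W"
  obtain U \<phi> where c: "(U, \<phi>) \<in> charts M" "p \<in> U" using chart_at p W openin_subset by blast
  define V where "V = U \<inter> W"
  have V: "openin (mtop M) V" "V \<subseteq> U" "V \<subseteq> W" "V \<subseteq> pts M"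
    using chartD[OF c(1)] W by (auto simp: V_def)
  obtain F :: "'n \<Rightarrow> 'a vfield" where "\<And>i. smooth_field M U (F i)"
    and orth: "\<And>i j q. i \<noteq> j \<Longrightarrow> q \<in> U \<Longrightarrow> g q (F i q) (F j q) = 0"
    and pos: "\<And>i q. q \<in> U \<Longrightarrow> g q (F i q) (F i q) > 0" using orthogonal_frame[OF c(1)] by blast
  then have F: "smooth_field M V (F i)" for i using smooth_field_subset V by blast
  have hV: "smooth_fun M V h" by (rule smooth_fun_subset[OF h V(1,3)])
  have coeff: "smooth_fun M V (\<lambda>q. F i q h / g q (F i q) (F i q))" for i
  proof (rule smooth_fun_divide[OF smooth_field_apply[OF F hV] g_smooth[OF F F]])
    show "g q (F i q) (F i q) \<noteq> 0" if "q \<in> V" for q using pos[of q i] V that by auto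
  qed
  have "smooth_field M V (\<lambda>q u. \<Sum>i\<in>UNIV. F i q h / g q (F i q) (F i q) * F i q u)"
    by (rule smooth_field_comb[OF V(1) coeff F])
  then have "smooth_field M V (grad M g h)"
  proof (rule smooth_field_cong)
    fix q assume q: "q \<in> V"
    with V have qU: "q \<in> U" "q \<in> pts M" by auto
    have "grad M g h q = (\<lambda>u. \<Sum>i\<in>UNIV. F i q h / g q (F i q) (F i q) * F i q u)"
      using qU smooth_field_tangent[OF F q] orth pos[OF qU(1)]
      by (intro grad_orthogonal(1)) (auto simp: less_imp_neq[symmetric])
    then show "(\<lambda>u. \<Sum>i\<in>UNIV. F i q h / g q (F i q) (F i q) * F i q u) = grad M g h q" by simp
  qed
  then show "\<exists>V. p \<in> V \<and> smooth_field M V (grad M g h)" using c(2) p by (auto simp: V_def)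
qed

end


section \<open>The Levi-Civita connection\<close>

locale levi_civita_mfd = riemannian_mfd M g for M :: "('a, 'n::finite) mfd" and g +
  fixes nabla :: "'a connection"
  assumes lc: "levi_civita M g nabla"
begin

lemma connection: "affine_connection M nabla"
  using lc unfolding levi_civita_def by blast

lemma nabla_smooth:
  "smooth_field M W X \<Longrightarrow> smooth_field M W Y \<Longrightarrow> smooth_field M W (nabla X Y)"
  using connection unfolding affine_connection_def by blast

lemma nabla_add:
  "smooth_field M W X \<Longrightarrow> smooth_field M W Y \<Longrightarrow> smooth_field M W Z \<Longrightarrow> q \<in> W \<Longrightarrow>
    nabla X (field_add Y Z) q = (\<lambda>u. nabla X Y q u + nabla X Z q u)"
  using connection unfolding affine_connection_def field_add_def by blast

lemma nabla_mult:
  "smooth_field M W X \<Longrightarrow> smooth_field M W Y \<Longrightarrow> smooth_fun M W h \<Longrightarrow> q \<in> W \<Longrightarrow>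
    nabla X (field_mult h Y) q = (\<lambda>u. X q h * Y q u + h q * nabla X Y q u)"
  using connection unfolding affine_connection_def field_add_def field_mult_def by blast

lemma torsion_free:
  "smooth_field M W X \<Longrightarrow> smooth_field M W Y \<Longrightarrow> q \<in> W \<Longrightarrow>
    lie_bracket M X Y q u = nabla X Y q u - nabla Y X q u"
  using lc unfolding levi_civita_def by metis

lemma metric_compatible:
  "smooth_field M W X \<Longrightarrow> smooth_field M W Y \<Longrightarrow> smooth_field M W Z \<Longrightarrow> q \<in> W \<Longrightarrow>
    X q (\<lambda>q. g q (Y q) (Z q)) = g q (nabla X Y q) (Z q) + g q (Y q) (nabla X Z q)"
  using lc unfolding levi_civita_def by blast

text \<open>Connections act on total functions, so it has to be shown that values off \<open>W\<close> do not matter.  The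
  difference field \<open>Z\<close> vanishes on \<open>W\<close> and equals \<open>h Z\<close> for the function \<open>h\<close> that is \<open>0\<close> on \<open>W\<close>
  and \<open>1\<close> elsewhere; the Leibniz rule then gives \<open>\<nabla>\<^sub>X Z = X(h) Z + h \<nabla>\<^sub>X Z = 0\<close> on \<open>W\<close>.\<close>

lemma nabla_cong:
  assumes X: "smooth_field M W X" and Y: "smooth_field M W Y"
    and eq: "\<And>q. q \<in> W \<Longrightarrow> Y q = Y' q" and p: "p \<in> W"
  shows "nabla X Y p = nabla X Y' p"
proof -
  define h :: "'a \<Rightarrow> real" where "h = (\<lambda>q. if q \<in> W then 0 else 1)"
  \<comment> \<open>multiplying by \<open>h\<close> sets the difference to zero on \<open>W\<close> itself\<close>
  define Z where "Z = field_mult h (\<lambda>q u. Y' q u - Y q u)"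
  have h: "smooth_fun M W h"
    by (rule smooth_fun_cong[OF smooth_fun_const[OF smooth_field_openin[OF X], of 0]])
       (simp add: h_def)
  have Z: "smooth_field M W Z"
    by (rule smooth_field_cong[OF smooth_field_mult[OF smooth_fun_const[OF smooth_field_openin[OF X], of 0] Y]])
       (simp add: Z_def h_def field_mult_def)
  have "Z = field_mult h Z" "Y' = field_add Y Z"
    unfolding Z_def h_def field_mult_def field_add_def using eq by (auto simp: fun_eq_iff)
  moreover have "nabla X (field_mult h Z) p = (\<lambda>_. 0)"
    unfolding nabla_mult[OF X Z h p] using p by (simp add: Z_def h_def field_mult_def)
  ultimately have "nabla X Z p = (\<lambda>_. 0)" by simp
  then show ?thesis using nabla_add[OF X Y Z p] \<open>Y' = field_add Y Z\<close> by simp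
qed

lemma lie_bracket_smooth:
  assumes X: "smooth_field M W X" and Y: "smooth_field M W Y"
  shows "smooth_field M W (lie_bracket M X Y)"
proof (rule smooth_field_cong)
  show "smooth_field M W (field_add (nabla X Y) (field_mult (\<lambda>_. - 1) (nabla Y X)))"
    by (intro smooth_field_add smooth_field_mult smooth_fun_const smooth_field_openin[OF X]
        nabla_smooth X Y)
qed (simp add: fun_eq_iff field_add_def field_mult_def torsion_free[OF X Y])

end


section \<open>Gradient almost quasi-Yamabe solitons\<close>

locale yamabe_soliton = levi_civita_mfd M g nabla
  for M :: "('a, 'n::finite) mfd" and g and nabla +
  fixes f lam mu :: "'a \<Rightarrow> real"
  assumes f_smooth: "smooth_fun M (pts M) f" and mu_smooth: "smooth_fun M (pts M) mu"
    and soliton: "gradient_almost_quasi_yamabe M g nabla f lam mu"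
begin

abbreviation xi :: "'a vfield" where "xi \<equiv> grad M g f"

abbreviation phi :: "'a \<Rightarrow> real" where "phi \<equiv> \<lambda>q. scal M g nabla q - lam q"

text \<open>The eigenvalue of \<open>\<nabla>\<xi>\<close> along \<open>\<xi>\<close>, that is \<open>\<nabla>\<^sub>\<xi> \<xi> = \<psi> \<xi>\<close>; also \<open>grad |\<xi>|\<^sup>2 = 2 \<psi> \<xi>\<close>.\<close>

abbreviation psi :: "'a \<Rightarrow> real" where "psi \<equiv> \<lambda>q. phi q - mu q * normsq g xi q"

lemma soliton_eq:
  assumes "smooth_field M W X" "smooth_field M W Y" "q \<in> W"
  shows "g q (nabla X xi q) (Y q) = phi q * g q (X q) (Y q) - mu q * (X q f * Y q f)"
proof -
  have "hess M g nabla f X Y q + (lam q - scal M g nabla q) * g q (X q) (Y q)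
      + mu q * (X q f * Y q f) = 0"
    using soliton assms unfolding gradient_almost_quasi_yamabe_def by blast
  then show ?thesis by (simp add: hess_def algebra_simps)
qed

lemma normsq_xi: "q \<in> pts M \<Longrightarrow> normsq g xi q = xi q f"
  by (simp add: normsq_def g_grad grad_tangent)

context
  fixes W assumes W: "openin (mtop M) W"
begin

lemma W_pts: "q \<in> W \<Longrightarrow> q \<in> pts M"
  using openin_subset[OF W] by blast

lemma xi_smooth: "smooth_field M W xi"
  by (rule grad_smooth[OF smooth_fun_subset[OF f_smooth W openin_subset[OF W]]])

lemma f_smooth_on: "smooth_fun M W f" and mu_smooth_on: "smooth_fun M W mu"
  using smooth_fun_subset[OF f_smooth W] smooth_fun_subset[OF mu_smooth W] openin_subset[OF W] by auto

lemma normsq_smooth: "smooth_fun M W (normsq g xi)"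
  using g_smooth[OF xi_smooth xi_smooth] by (simp add: normsq_def[abs_def])

text \<open>Smoothness of \<open>scal - \<lambda>\<close> is read off from the soliton equation itself: evaluated on a local field
  \<open>X\<close> without zeros it expresses \<open>\<phi> g(X,X)\<close> by smooth functions.\<close>

lemma phi_smooth: "smooth_fun M W phi"
proof (rule smooth_fun_local[OF W])
  fix p assume p: "p \<in> W"
  obtain U \<phi> where c: "(U, \<phi>) \<in> charts M" "p \<in> U" using chart_at W_pts[OF p] by blast
  define V where "V = U \<inter> W"
  have V: "openin (mtop M) V" "V \<subseteq> U" "V \<subseteq> W"
    using chartD[OF c(1)] W by (auto simp: V_def)
  obtain F :: "'n \<Rightarrow> 'a vfield" where F: "\<And>i. smooth_field M U (F i)"
    and pos: "\<And>i q. q \<in> U \<Longrightarrow> g q (F i q) (F i q) > 0"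
    using orthogonal_frame[OF c(1)] by metis
  define X where "X = F undefined"
  have X: "smooth_field M V X" unfolding X_def by (rule smooth_field_subset[OF F V(1,2)])
  have nz: "g q (X q) (X q) \<noteq> 0" if "q \<in> V" for q
    using pos[of q undefined] V(2) that by (auto simp: X_def)
  have fV: "smooth_fun M V f" and muV: "smooth_fun M V mu" and xiV: "smooth_field M V xi"
    using smooth_fun_subset[OF f_smooth_on V(1,3)] smooth_fun_subset[OF mu_smooth_on V(1,3)]
      smooth_field_subset[OF xi_smooth V(1,3)] by auto
  note Xf = smooth_field_apply[OF X fV]
  have "smooth_fun M V (\<lambda>q. (g q (nabla X xi q) (X q) + mu q * (X q f * X q f)) / g q (X q) (X q))"
    by (rule smooth_fun_divide[OF smooth_fun_add[OF g_smooth[OF nabla_smooth[OF X xiV] X]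
            smooth_fun_mult[OF muV smooth_fun_mult[OF Xf Xf]]] g_smooth[OF X X] nz])
  then have "smooth_fun M V phi"
    by (rule smooth_fun_cong) (use soliton_eq[OF X X] nz in auto)
  then show "\<exists>V. p \<in> V \<and> smooth_fun M V phi" using c(2) p by (auto simp: V_def)
qed

text \<open>The soliton equation in the form \<open>\<nabla>\<^sub>X \<xi> = \<phi> X - \<mu> df(X) \<xi>\<close>, by non-degeneracy of \<open>g\<close>.\<close>

lemma nabla_xi:
  assumes X: "smooth_field M W X" and p: "p \<in> W"
  shows "nabla X xi p = (\<lambda>u. phi p * X p u + (- (mu p * X p f)) * xi p u)"
proof (rule tangent_eqI[OF W_pts[OF p]])
  note pM = W_pts[OF p] and Xp = smooth_field_tangent[OF X p]
  show "nabla X xi p \<in> tangent_space M p"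
    by (rule smooth_field_tangent[OF nabla_smooth[OF X xi_smooth] p])
  show "(\<lambda>u. phi p * X p u + (- (mu p * X p f)) * xi p u) \<in> tangent_space M p"
    by (rule tangent_lin[OF pM Xp grad_tangent[OF pM]])
  fix z assume z: "z \<in> tangent_space M p"
  then obtain V Z where V: "p \<in> V" "smooth_field M V Z" "Z p = z" using tangent_extend[OF pM] by blast
  have VW: "openin (mtop M) (V \<inter> W)" using W smooth_field_openin[OF V(2)] by blast
  have "smooth_field M (V \<inter> W) X" "smooth_field M (V \<inter> W) Z"
    using smooth_field_subset[OF X VW] smooth_field_subset[OF V(2) VW] by auto
  from soliton_eq[OF this, of p] p V
  have "g p (nabla X xi p) z = phi p * g p (X p) z - mu p * (X p f * z f)" by simp
  also have "\<dots> = g p (\<lambda>u. phi p * X p u + (- (mu p * X p f)) * xi p u) z"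
    unfolding g_lin[OF pM Xp grad_tangent[OF pM] z] by (simp add: g_grad[OF pM z])
  finally show "g p (nabla X xi p) z = g p (\<lambda>u. phi p * X p u + (- (mu p * X p f)) * xi p u) z" .
qed

lemma nabla_xi_xi:
  assumes p: "p \<in> W"
  shows "nabla xi xi p = field_mult psi xi p"
  unfolding nabla_xi[OF xi_smooth p] field_mult_def
  by (simp add: normsq_xi[OF W_pts[OF p]] algebra_simps)

lemma psi_smooth: "smooth_fun M W psi"
proof -
  have "smooth_fun M W (\<lambda>q. phi q + (- 1) * (mu q * normsq g xi q))"
    by (intro smooth_fun_add smooth_fun_mult smooth_fun_const W phi_smooth mu_smooth_on normsq_smooth)
  then show ?thesis by simp
qed

lemma derivative_normsq:
  assumes X: "smooth_field M W X" and p: "p \<in> W"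
  shows "X p (normsq g xi) = 2 * psi p * X p f"
proof -
  note pM = W_pts[OF p] and Xp = smooth_field_tangent[OF X p]
  note xip = grad_tangent[OF pM, of f]
  have nt: "nabla X xi p \<in> tangent_space M p"
    by (rule smooth_field_tangent[OF nabla_smooth[OF X xi_smooth] p])
  have "X p (normsq g xi) = 2 * g p (nabla X xi p) (xi p)"
    using metric_compatible[OF X xi_smooth xi_smooth p] g_sym[OF pM xip nt]
    by (simp add: normsq_def[abs_def])
  also have "g p (nabla X xi p) (xi p) = phi p * X p f - mu p * X p f * xi p f"
    unfolding nabla_xi[OF X p] g_lin[OF pM Xp xip xip]
    by (simp add: g_sym[OF pM Xp xip] g_grad[OF pM] Xp xip)
  finally show ?thesis by (simp add: normsq_xi[OF pM] algebra_simps)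
qed

lemma derivative_psi:
  assumes X: "smooth_field M W X" and p: "p \<in> W"
  shows "X p psi = X p phi - (mu p * (2 * psi p * X p f) + X p mu * normsq g xi p)"
  unfolding tangent_diff[OF smooth_field_tangent[OF X p] phi_smooth
      smooth_fun_mult[OF mu_smooth_on normsq_smooth] p]
    tangent_mult[OF smooth_field_tangent[OF X p] mu_smooth_on normsq_smooth p]
    derivative_normsq[OF X p] ..

text \<open>\<open>A\<close>, \<open>B\<close> and \<open>C\<close> are the three terms of \<open>R(X,\<xi>)\<xi>\<close>.  The unknown field \<open>\<nabla>\<^sub>\<xi> X\<close> occurs in \<open>B\<close> and,
  through torsion-freeness, in \<open>C\<close>, and cancels; so does the second derivative \<open>\<xi>(X(f))\<close>.\<close>

lemma curvature_xi:
  assumes X: "smooth_field M W X" and p: "p \<in> W"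
  shows "curvature M nabla X xi xi p = (\<lambda>u.
      (X p phi - normsq g xi p * X p mu + (xi p mu + mu p * phi p) * X p f) * xi p u
      + (- (xi p phi + mu p * phi p * normsq g xi p)) * X p u)"
proof
  fix u
  note pM = W_pts[OF p]
  define s where "s = normsq g xi p"
  define k where "k = (\<lambda>q. - 1 * (mu q * X q f))"
  note Xf = smooth_field_apply[OF X f_smooth_on]
  have k: "smooth_fun M W k"
    unfolding k_def by (intro smooth_fun_mult[OF smooth_fun_const[OF W]] smooth_fun_mult mu_smooth_on Xf)
  have A: "nabla X (nabla xi xi) p u = X p psi * xi p u + psi p * nabla X xi p u"
    using nabla_cong[OF X nabla_smooth[OF xi_smooth xi_smooth] nabla_xi_xi p]
      nabla_mult[OF X xi_smooth psi_smooth p] by simp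
  have "nabla X xi q = field_add (field_mult phi X) (field_mult k xi) q" if "q \<in> W" for q
    unfolding nabla_xi[OF X that] by (simp add: field_add_def field_mult_def k_def)
  from nabla_cong[OF xi_smooth nabla_smooth[OF X xi_smooth] this p]
    nabla_add[OF xi_smooth smooth_field_mult[OF phi_smooth X] smooth_field_mult[OF k xi_smooth] p]
    nabla_mult[OF xi_smooth X phi_smooth p] nabla_mult[OF xi_smooth xi_smooth k p]
  have B: "nabla xi (nabla X xi) p u = xi p phi * X p u + phi p * nabla xi X p u
      + (xi p k * xi p u + k p * (psi p * xi p u))"
    using nabla_xi_xi[OF p] by (simp add: field_mult_def)
  have C: "nabla (lie_bracket M X xi) xi p u = phi p * lie_bracket M X xi p u
      - mu p * lie_bracket M X xi p f * xi p u"
    unfolding nabla_xi[OF lie_bracket_smooth[OF X xi_smooth] p] by simp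
  have br: "lie_bracket M X xi p u = nabla X xi p u - nabla xi X p u"
    by (rule torsion_free[OF X xi_smooth p])
  have "X p (\<lambda>q. xi q f) = X p (normsq g xi)"
    by (rule tangent_cong[OF smooth_field_tangent[OF X p] smooth_field_apply[OF xi_smooth f_smooth_on] p])
       (simp add: normsq_xi W_pts)
  then have brf: "lie_bracket M X xi p f = 2 * psi p * X p f - xi p (\<lambda>q. X q f)"
    using smooth_nearI[OF f_smooth_on p] derivative_normsq[OF X p] by (simp add: lie_bracket_def)
  have xik: "xi p k = - (mu p * xi p (\<lambda>q. X q f) + xi p mu * X p f)"
    unfolding k_def tangent_cmult[OF grad_tangent[OF pM] smooth_fun_mult[OF mu_smooth_on Xf] p]
      tangent_mult[OF grad_tangent[OF pM] mu_smooth_on Xf p] by simp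
  have nX: "nabla X xi p u = phi p * X p u - mu p * X p f * xi p u"
    unfolding nabla_xi[OF X p] by simp
  have kp: "k p = - (mu p * X p f)" by (simp add: k_def)
  show "curvature M nabla X xi xi p u =
      (X p phi - normsq g xi p * X p mu + (xi p mu + mu p * phi p) * X p f) * xi p u
      + (- (xi p phi + mu p * phi p * normsq g xi p)) * X p u"
    unfolding curvature_def A B C br brf xik kp derivative_psi[OF X p] nX s_def[symmetric]
    by algebra
qed

end

text \<open>Both are the identity \<open>\<xi> = \<Sum>\<^sub>i E\<^sub>i(f) E\<^sub>i\<close>.\<close>

lemma frame_sums:
  assumes E: "frame_at M g p E"
  shows "(\<Sum>i\<in>UNIV. E i p h * E i p f) = xi p h"
    and "(\<Sum>i\<in>UNIV. E i p f * E i p f) = normsq g xi p"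
  using grad_frame[OF E, of f h] grad_frame[OF E, of f f] normsq_xi[OF frame_atD(1)[OF E]]
  by (simp_all add: mult.commute)

lemma frame_nbhd:
  assumes "frame_at M g p E"
  obtains W where "openin (mtop M) W" "p \<in> W" "\<And>i. smooth_field M W (E i)"
  using assms smooth_field_openin unfolding frame_at_def by blast

text \<open>In the trace of \<open>X \<mapsto> R(X,\<xi>)\<xi>\<close> the terms with \<open>\<xi>(\<mu>)\<close> cancel.  The result determines
  \<open>\<xi>(\<phi>)\<close>, the only derivative of \<open>scal\<close> and \<open>\<lambda>\<close> in the Laplacian of \<open>|\<xi>|\<^sup>2\<close>, by the Ricci
  curvature.\<close>

lemma ricci_xi_xi:
  assumes p: "p \<in> pts M"
  shows "ricci M g nabla xi xi p =
    - (real CARD('n) - 1) * (xi p phi + mu p * phi p * normsq g xi p)"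
proof -
  let ?E = "some_frame M g p"
  have E: "frame_at M g p ?E" by (rule some_frame_at[OF p])
  obtain W where W: "openin (mtop M) W" "p \<in> W" "\<And>i. smooth_field M W (?E i)"
    using frame_nbhd[OF E] by blast
  define s where "s = normsq g xi p"
  define b where "b = xi p phi + mu p * phi p * s"
  have "g p (curvature M nabla (?E i) xi xi p) (?E i p) =
      ?E i p phi * ?E i p f - s * (?E i p mu * ?E i p f)
      + (xi p mu + mu p * phi p) * (?E i p f * ?E i p f) - b" for i
    unfolding curvature_xi[OF W(1,3,2)]
      g_lin[OF p grad_tangent[OF p] frame_atD(2)[OF E] frame_atD(2)[OF E]]
    by (simp add: g_grad[OF p frame_atD(2)[OF E]] frame_atD(3)[OF E] b_def s_def algebra_simps)
  then have "ricci M g nabla xi xi p =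
      xi p phi - s * xi p mu + (xi p mu + mu p * phi p) * s - real CARD('n) * b"
    unfolding ricci_def trace_at_def
    by (simp add: sum.distrib sum_subtractf sum_distrib_left[symmetric] frame_sums[OF E] s_def
        normsq_xi[OF p])
  then show ?thesis unfolding b_def s_def[symmetric] by (simp add: algebra_simps)
qed

lemma end_normsq_nabla_xi:
  assumes p: "p \<in> pts M"
  shows "end_normsq M g p (\<lambda>X. nabla X xi) = real CARD('n) * (phi p)\<^sup>2
    - 2 * phi p * mu p * normsq g xi p + (mu p)\<^sup>2 * (normsq g xi p)\<^sup>2"
proof -
  let ?E = "some_frame M g p"
  have E: "frame_at M g p ?E" by (rule some_frame_at[OF p])
  obtain W where W: "openin (mtop M) W" "p \<in> W" "\<And>i. smooth_field M W (?E i)"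
    using frame_nbhd[OF E] by blast
  note xip = grad_tangent[OF p, of f] and Ep = frame_atD(2)[OF E]
  have "g p (nabla (?E i) xi p) (nabla (?E i) xi p) = (phi p)\<^sup>2
      - 2 * phi p * mu p * (?E i p f * ?E i p f)
      + (mu p)\<^sup>2 * normsq g xi p * (?E i p f * ?E i p f)" for i
  proof -
    have t: "nabla (?E i) xi p \<in> tangent_space M p"
      by (rule smooth_field_tangent[OF nabla_smooth[OF W(3) xi_smooth[OF W(1)]] W(2)])
    have l: "g p (nabla (?E i) xi p) z = phi p * g p (?E i p) z - mu p * ?E i p f * z f"
      if z: "z \<in> tangent_space M p" for z
      unfolding nabla_xi[OF W(1,3,2)] g_lin[OF p Ep xip z] by (simp add: g_grad[OF p z])
    have 1: "g p (?E i p) (nabla (?E i) xi p) = phi p - mu p * ?E i p f * ?E i p f"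
      using g_sym[OF p Ep t] l[OF Ep] frame_atD(3)[OF E] by simp
    have 2: "nabla (?E i) xi p f = phi p * ?E i p f - mu p * ?E i p f * normsq g xi p"
      unfolding nabla_xi[OF W(1,3,2)] by (simp add: normsq_xi[OF p])
    show ?thesis
      unfolding l[OF t] 1 2 by (simp add: power2_eq_square algebra_simps)
  qed
  then show ?thesis
    unfolding end_normsq_def
    by (simp add: sum.distrib sum_subtractf sum_distrib_left[symmetric] frame_sums[OF E]
        normsq_xi[OF p] power2_eq_square)
qed

lemma grad_normsq:
  assumes p: "p \<in> pts M"
  shows "grad M g (normsq g xi) p = (\<lambda>u. 2 * psi p * xi p u)"
proof (rule grad_eqI[OF p])
  show "(\<lambda>u. 2 * psi p * xi p u) \<in> tangent_space M p"
    by (rule tangent_scale[OF p grad_tangent[OF p]])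
  fix w assume w: "w \<in> tangent_space M p"
  then obtain V Z where V: "p \<in> V" "smooth_field M V Z" "Z p = w" using tangent_extend[OF p] by blast
  show "g p (\<lambda>u. 2 * psi p * xi p u) w = w (normsq g xi)"
    unfolding g_scale[OF p grad_tangent[OF p] w] g_grad[OF p w]
    using derivative_normsq[OF smooth_field_openin[OF V(2)] V(2,1)] V(3) by simp
qed

text \<open>The divergence of \<open>2 \<psi> \<xi>\<close>, with \<open>div \<xi> = n \<phi> - \<mu> |\<xi>|\<^sup>2\<close>.\<close>

lemma laplacian_normsq:
  assumes p: "p \<in> pts M"
  shows "laplacian M g nabla (normsq g xi) p =
    2 * xi p psi + 2 * psi p * (real CARD('n) * phi p - mu p * normsq g xi p)"
proof -
  let ?E = "some_frame M g p"
  have E: "frame_at M g p ?E" by (rule some_frame_at[OF p])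
  obtain W where W: "openin (mtop M) W" "p \<in> W" "\<And>i. smooth_field M W (?E i)"
    using frame_nbhd[OF E] by blast
  note xip = grad_tangent[OF p, of f] and Ep = frame_atD(2)[OF E]
  let ?P = "\<lambda>q. 2 * psi q"
  have P: "smooth_fun M W ?P"
    by (rule smooth_fun_mult[OF smooth_fun_const[OF W(1)] psi_smooth[OF W(1)]])
  have "g p (nabla (?E i) (grad M g (normsq g xi)) p) (?E i p) =
      2 * (?E i p psi * ?E i p f) + 2 * psi p * (phi p - mu p * (?E i p f * ?E i p f))" for i
  proof -
    have t: "nabla (?E i) xi p \<in> tangent_space M p"
      by (rule smooth_field_tangent[OF nabla_smooth[OF W(3) xi_smooth[OF W(1)]] W(2)])
    have "nabla (?E i) (grad M g (normsq g xi)) p = nabla (?E i) (field_mult ?P xi) p"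
      by (rule nabla_cong[OF W(3) grad_smooth[OF normsq_smooth[OF W(1)]] _ W(2)])
         (simp add: grad_normsq[OF W_pts[OF W(1)]] field_mult_def)
    also have "\<dots> = (\<lambda>u. ?E i p ?P * xi p u + ?P p * nabla (?E i) xi p u)"
      by (rule nabla_mult[OF W(3) xi_smooth[OF W(1)] P W(2)])
    also have "?E i p ?P = 2 * ?E i p psi"
      by (rule tangent_cmult[OF Ep psi_smooth[OF W(1)] W(2)])
    finally have 1: "nabla (?E i) (grad M g (normsq g xi)) p =
        (\<lambda>u. 2 * ?E i p psi * xi p u + ?P p * nabla (?E i) xi p u)" .
    have 2: "g p (nabla (?E i) xi p) (?E i p) = phi p - mu p * (?E i p f * ?E i p f)"
      using soliton_eq[OF W(3,3,2)] frame_atD(3)[OF E] by simp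
    show ?thesis unfolding 1 g_lin[OF p xip t Ep] g_grad[OF p Ep] 2 by simp
  qed
  then have "laplacian M g nabla (normsq g xi) p =
      (\<Sum>i\<in>UNIV. 2 * (?E i p psi * ?E i p f) + 2 * psi p * (phi p - mu p * (?E i p f * ?E i p f)))"
    unfolding laplacian_def divergence_def trace_at_def by simp
  also have "\<dots> = 2 * xi p psi + 2 * psi p * (real CARD('n) * phi p - mu p * normsq g xi p)"
    unfolding sum.distrib sum_distrib_left[symmetric] sum_subtractf frame_sums[OF E]
    by (simp add: normsq_xi[OF p] algebra_simps)
  finally show ?thesis .
qed

end

theorem theorem2p1:
  fixes M :: "('a, 'n::finite) mfd"
    and g :: "'a metric"
    and nabla :: "'a connection"
    and f lam mu :: "'a \<Rightarrow> real"
    and xi :: "'a vfield"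
    and n :: nat
    and p :: 'a
  assumes "smooth_manifold M"
    and "n = CARD('n)" and "n > 2"
    and "riemannian_metric M g"
    and "levi_civita M g nabla"
    and "smooth_fun M (pts M) f" and "smooth_fun M (pts M) lam" and "smooth_fun M (pts M) mu"
    and "xi = grad M g f"
    and "gradient_almost_quasi_yamabe M g nabla f lam mu"
    and "p \<in> pts M"
  shows "1 / 2 * laplacian M g nabla (normsq g xi) p =
      end_normsq M g p (\<lambda>X. nabla X xi)
      - 1 / (real n - 1) * ricci M g nabla xi xi p
      - (real n - 2) / (2 * (real n - 1)) * mu p * xi p (normsq g xi)
      - normsq g xi p *
          (xi p mu
           - real n / (real n - 1) * (mu p)\<^sup>2 * normsq g xi p
           - (real n)\<^sup>2 / (real n - 1) * lam p * mu p
           + (real n)\<^sup>2 / (real n - 1) * mu p * scal M g nabla p)"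
proof -
  interpret yamabe_soliton M g nabla f lam mu
    using assms by unfold_locales auto
  note p = \<open>p \<in> pts M\<close>
  have top: "openin (mtop M) (pts M)" by simp
  define s where "s = normsq g xi p"
  define r where "r = scal M g nabla p"
  define a where "a = r - lam p"
  define d where "d = xi p phi"
  have xis: "xi p (normsq g xi) = 2 * (a - mu p * s) * s"
    using derivative_normsq[OF top xi_smooth[OF top] p] normsq_xi[OF p]
    unfolding \<open>xi = grad M g f\<close>[symmetric] s_def a_def r_def by simp
  have xipsi: "xi p psi = d - (mu p * (2 * (a - mu p * s) * s) + xi p mu * s)"
    using derivative_psi[OF top xi_smooth[OF top] p] normsq_xi[OF p]
    unfolding \<open>xi = grad M g f\<close>[symmetric] s_def a_def r_def d_def by simp
  have L: "1 / 2 * laplacian M g nabla (normsq g xi) p =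
      d - (mu p * (2 * (a - mu p * s) * s) + xi p mu * s) + (a - mu p * s) * (n * a - mu p * s)"
    using laplacian_normsq[OF p] xipsi
    unfolding \<open>xi = grad M g f\<close>[symmetric] \<open>n = CARD('n)\<close>[symmetric] s_def a_def r_def by simp
  have N: "end_normsq M g p (\<lambda>X. nabla X xi) = n * a\<^sup>2 - 2 * a * mu p * s + (mu p)\<^sup>2 * s\<^sup>2"
    using end_normsq_nabla_xi[OF p]
    unfolding \<open>xi = grad M g f\<close>[symmetric] \<open>n = CARD('n)\<close>[symmetric] s_def a_def r_def by simp
  have R: "ricci M g nabla xi xi p = - (real n - 1) * (d + mu p * a * s)"
    using ricci_xi_xi[OF p]
    unfolding \<open>xi = grad M g f\<close>[symmetric] \<open>n = CARD('n)\<close>[symmetric] s_def a_def r_def d_def by simp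
  \<comment> \<open>the remaining identity is polynomial in \<open>n\<close> after clearing the denominator \<open>n - 1\<close>\<close>
  define m where "m = real n - 1"
  have n: "real n = m + 1" and m: "m \<noteq> 0" using \<open>n > 2\<close> by (auto simp: m_def)
  have r: "r = a + lam p" by (simp add: a_def)
  show ?thesis
    unfolding L N R xis s_def[symmetric] r_def[symmetric] unfolding n r
    using m by (simp add: field_simps) algebra
qed

end
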